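(* There exists a free minimal action $\alpha$ of $\mathbb Z^2$ on the Cantor space $X$ such that the topological full group $[\![\alpha]\!]$ does not have any dense, locally finite subgroup.
   Context: $[\![\alpha]\!]$ is the group of homeomorphisms $g$ of $X$ for which there exist a clopen partition $X=\bigsqcup_{i=1}^n A_i$ and $\gamma_1,\dots,\gamma_n\in\mathbb Z^2$ with $g(x)=\alpha(\gamma_i)(x)$ for $x\in A_i$. $\mathrm{Homeo}(X)$ carries the topology whose basic identity neighbourhoods are the subgroups $\{g: gA=A\ \forall A\in\mathcal A\}$ for finite clopen partitions $\mathcal A$; density is with respect to the induced topology on $[\![\alpha]\!]$. *)

theory Defs
  imports "HOL-Analysis.Analysis"
begin

text \<open>The Cantor space, modelled as the product space of countably many
  copies of the discrete two-point space.\<close>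
type_synonym cantor = "nat \<Rightarrow> bool"

definition Homeo :: "(cantor \<Rightarrow> cantor) set" where
  "Homeo = {f. \<exists>g. homeomorphism UNIV UNIV f g}"

definition Z2_action :: "(int \<times> int \<Rightarrow> cantor \<Rightarrow> cantor) \<Rightarrow> bool" where
  "Z2_action \<alpha> \<longleftrightarrow>
     (\<forall>\<gamma>. continuous_on UNIV (\<alpha> \<gamma>)) \<and>
     \<alpha> (0, 0) = id \<and>
     (\<forall>a b c d. \<alpha> (a + c, b + d) = \<alpha> (a, b) \<circ> \<alpha> (c, d))"

definition free_action :: "(int \<times> int \<Rightarrow> cantor \<Rightarrow> cantor) \<Rightarrow> bool" where
  "free_action \<alpha> \<longleftrightarrow> (\<forall>\<gamma> x. \<alpha> \<gamma> x = x \<longrightarrow> \<gamma> = (0, 0))"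

definition minimal_action :: "(int \<times> int \<Rightarrow> cantor \<Rightarrow> cantor) \<Rightarrow> bool" where
  "minimal_action \<alpha> \<longleftrightarrow> (\<forall>x. closure (range (\<lambda>\<gamma>. \<alpha> \<gamma> x)) = UNIV)"

definition clopen_partition :: "cantor set set \<Rightarrow> bool" where
  "clopen_partition \<P> \<longleftrightarrow> finite \<P> \<and> \<Union>\<P> = UNIV \<and>
     (\<forall>A\<in>\<P>. open A \<and> closed A \<and> A \<noteq> {}) \<and>
     (\<forall>A\<in>\<P>. \<forall>B\<in>\<P>. A \<noteq> B \<longrightarrow> A \<inter> B = {})"

definition TFG :: "(int \<times> int \<Rightarrow> cantor \<Rightarrow> cantor) \<Rightarrow> (cantor \<Rightarrow> cantor) set" where
  "TFG \<alpha> = {g \<in> Homeo. \<exists>\<P> \<gamma>. clopen_partition \<P> \<and>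
                (\<forall>A\<in>\<P>. \<forall>x\<in>A. g x = \<alpha> (\<gamma> A) x)}"

text \<open>Basic open sets of the topology on Homeo(X): left translates g U of the
  basic identity neighbourhoods U = {h. h A = A for all A in P}.\<close>
definition homeo_basic_nbhd :: "(cantor \<Rightarrow> cantor) \<Rightarrow> cantor set set \<Rightarrow> (cantor \<Rightarrow> cantor) set" where
  "homeo_basic_nbhd g \<P> = {h \<in> Homeo. \<forall>A\<in>\<P>. (inv g \<circ> h) ` A = A}"

definition homeo_topology :: "(cantor \<Rightarrow> cantor) topology" where
  "homeo_topology = topology_generated_by
     {homeo_basic_nbhd g \<P> | g \<P>. g \<in> Homeo \<and> clopen_partition \<P>}"

definition is_subgroup :: "(cantor \<Rightarrow> cantor) set \<Rightarrow> bool" where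
  "is_subgroup H \<longleftrightarrow> H \<subseteq> Homeo \<and> id \<in> H \<and>
     (\<forall>f\<in>H. \<forall>g\<in>H. f \<circ> g \<in> H) \<and> (\<forall>f\<in>H. inv f \<in> H)"

definition generated_subgroup :: "(cantor \<Rightarrow> cantor) set \<Rightarrow> (cantor \<Rightarrow> cantor) set" where
  "generated_subgroup S = \<Inter>{K. is_subgroup K \<and> S \<subseteq> K}"

definition locally_finite_group :: "(cantor \<Rightarrow> cantor) set \<Rightarrow> bool" where
  "locally_finite_group H \<longleftrightarrow>
     (\<forall>S. finite S \<and> S \<subseteq> H \<longrightarrow> finite (generated_subgroup S))"

end

theory Submission
  imports Defs "HOL-Library.Fun_Lexorder"
begin

text \<open>The obstruction is 2-torsion in the coinvariants of \<open>C(X, \<int>)\<close>. Let \<open>S\<close>, \<open>T\<close> be the two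
  generators and \<open>P\<close>, \<open>Q\<close> clopen sets whose indicators satisfy
  \<open>(1\<^sub>P \<circ> T - 1\<^sub>P) - (1\<^sub>Q \<circ> S - 1\<^sub>Q) = 2 h\<close> with \<open>h\<close> integer valued. If a dense subgroup is locally
  finite, it contains a finite group \<open>F\<close> with elements sending \<open>P\<close> to \<open>T\<^sup>-\<^sup>1P\<close> and \<open>Q\<close> to \<open>S\<^sup>-\<^sup>1Q\<close>, so
  \<open>h\<close> sums to zero over every orbit of \<open>F\<close> and is therefore a coboundary. Hence the cocycle
  \<open>(1\<^sub>P, 1\<^sub>Q)\<close> modulo 2 lifts to an integer valued cocycle.

  A system without such a lift (compare Matui, Torsion in coinvariants of certain Cantor minimal
  \<open>\<int>\<^sup>2\<close>-systems) is the orbit closure of the array \<open>u i + u j\<close>, where \<open>u\<close> is a generalized Morse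
  sequence over \<open>G = (\<int>/2)\<^sup>2\<close>. With \<open>P = {x. x\<^sub>1(0,0) = 1, x\<^sub>2(1,0) \<noteq> x\<^sub>2(0,0)}\<close> a
  lift is refuted by summing it over four rectangles whose sides run between occurrences of long
  words \<open>w\<close> and \<open>w + g\<close>, with \<open>g\<close> running through generators of \<open>G\<close>.\<close>

section \<open>Continuity on products of two-point spaces\<close>

text \<open>A basic box restricts finitely many coordinates, and on each of them it can be shrunk to
  the value of \<open>x\<close>. Topology thereby reduces to statements about finite sets of
  coordinates.\<close>

lemma open_fun_bool_iff:
  fixes U :: "('i \<Rightarrow> bool) set"
  shows "open U \<longleftrightarrow> (\<forall>x\<in>U. \<exists>J. finite J \<and> {y. \<forall>i\<in>J. y i = x i} \<subseteq> U)"
proof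
  assume U: "open U"
  show "\<forall>x\<in>U. \<exists>J. finite J \<and> {y. \<forall>i\<in>J. y i = x i} \<subseteq> U"
  proof
    fix x assume "x \<in> U"
    then obtain Y where Y: "x \<in> Pi\<^sub>E UNIV Y" "finite {i. Y i \<noteq> topspace euclidean}" "Pi\<^sub>E UNIV Y \<subseteq> U"
      using product_topology_open_contains_basis[of "\<lambda>_. euclidean" UNIV U x] U
      unfolding open_fun_def by blast
    have "{y. \<forall>i\<in>{i. Y i \<noteq> UNIV}. y i = x i} \<subseteq> Pi\<^sub>E UNIV Y"
    proof
      fix y assume y: "y \<in> {y. \<forall>i\<in>{i. Y i \<noteq> UNIV}. y i = x i}"
      have "y i \<in> Y i" for i using y Y(1) by (cases "Y i = UNIV") (auto simp: PiE_iff)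
      then show "y \<in> Pi\<^sub>E UNIV Y" by (simp add: PiE_iff)
    qed
    with Y show "\<exists>J. finite J \<and> {y. \<forall>i\<in>J. y i = x i} \<subseteq> U"
      by (intro exI[of _ "{i. Y i \<noteq> UNIV}"]) auto
  qed
next
  assume r: "\<forall>x\<in>U. \<exists>J. finite J \<and> {y. \<forall>i\<in>J. y i = x i} \<subseteq> U"
  have o: "open {y. \<forall>i\<in>J. y i = x i}" if "finite J" for J and x :: "'i \<Rightarrow> bool"
  proof -
    have "{y. \<forall>i\<in>J. y i = x i} = Pi\<^sub>E UNIV (\<lambda>i. if i \<in> J then {x i} else UNIV)"
      by (auto simp: PiE_iff split: if_splits)
    also have "open \<dots>"
    proof (rule open_PiE)
      show "finite {i. (if i \<in> J then {x i} else UNIV) \<noteq> UNIV}"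
        by (rule finite_subset[OF _ that]) auto
    qed (auto simp: open_discrete)
    finally show ?thesis .
  qed
  show "open U"
  proof (rule Topological_Spaces.openI)
    fix x assume "x \<in> U"
    with r obtain J where J: "finite J" "{y. \<forall>i\<in>J. y i = x i} \<subseteq> U" by blast
    show "\<exists>T. open T \<and> x \<in> T \<and> T \<subseteq> U"
      by (intro exI[of _ "{y. \<forall>i\<in>J. y i = x i}"] conjI o J) simp
  qed
qed

lemma open_cylinder: "finite J \<Longrightarrow> open {y :: 'i \<Rightarrow> bool. \<forall>i\<in>J. y i = x i}"
  unfolding open_fun_bool_iff by (intro ballI exI[of _ J]) auto

lemma closure_fun_bool_iff:
  "x \<in> closure A \<longleftrightarrow> (\<forall>J. finite J \<longrightarrow> (\<exists>y\<in>A. \<forall>i\<in>J. y i = (x :: 'i \<Rightarrow> bool) i))"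
proof -
  have "x \<in> closure A \<longleftrightarrow> (\<forall>U. open U \<longrightarrow> x \<in> U \<longrightarrow> A \<inter> U \<noteq> {})"
    unfolding closure_iff_nhds_not_empty by blast
  also have "\<dots> \<longleftrightarrow> (\<forall>J. finite J \<longrightarrow> (\<exists>y\<in>A. \<forall>i\<in>J. y i = x i))"
  proof safe
    fix J :: "'i set" assume *: "\<forall>U. open U \<longrightarrow> x \<in> U \<longrightarrow> A \<inter> U \<noteq> {}" "finite J"
    from *(1)[rule_format, OF open_cylinder[OF *(2), of x]] show "\<exists>y\<in>A. \<forall>i\<in>J. y i = x i" by auto
  next
    fix U assume *: "\<forall>J. finite J \<longrightarrow> (\<exists>y\<in>A. \<forall>i\<in>J. y i = x i)" "open U" "x \<in> U" "A \<inter> U = {}"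
    from *(2,3) obtain J where "finite J" "{y. \<forall>i\<in>J. y i = x i} \<subseteq> U"
      unfolding open_fun_bool_iff by blast
    with *(1,4) show False by blast
  qed
  finally show ?thesis .
qed

lemma continuous_on_fun_bool_iff:
  fixes f :: "('i \<Rightarrow> bool) \<Rightarrow> 'b :: discrete_topology"
  shows "continuous_on C f \<longleftrightarrow>
    (\<forall>x\<in>C. \<exists>J. finite J \<and> (\<forall>y\<in>C. (\<forall>i\<in>J. y i = x i) \<longrightarrow> f y = f x))"
proof
  assume c: "continuous_on C f"
  show "\<forall>x\<in>C. \<exists>J. finite J \<and> (\<forall>y\<in>C. (\<forall>i\<in>J. y i = x i) \<longrightarrow> f y = f x)"
  proof
    fix x assume "x \<in> C"
    from c have "open {f x} \<Longrightarrow> \<exists>A. open A \<and> A \<inter> C = f -` {f x} \<inter> C"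
      unfolding continuous_on_open_invariant by blast
    then obtain A where A: "open A" "A \<inter> C = f -` {f x} \<inter> C" by (auto simp: open_discrete)
    with \<open>x \<in> C\<close> have "x \<in> A" by blast
    with A(1) obtain J where "finite J" "{y. \<forall>i\<in>J. y i = x i} \<subseteq> A"
      unfolding open_fun_bool_iff by blast
    with A(2) show "\<exists>J. finite J \<and> (\<forall>y\<in>C. (\<forall>i\<in>J. y i = x i) \<longrightarrow> f y = f x)" by blast
  qed
next
  assume r: "\<forall>x\<in>C. \<exists>J. finite J \<and> (\<forall>y\<in>C. (\<forall>i\<in>J. y i = x i) \<longrightarrow> f y = f x)"
  show "continuous_on C f"
    unfolding continuous_on_open_invariant
  proof (intro allI impI)
    fix B :: "'b set"
    define A where "A = \<Union>{{y. \<forall>i\<in>J. y i = x i} | x J. finite J \<and> x \<in> C \<and> f x \<in> B \<and>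
      (\<forall>y\<in>C. (\<forall>i\<in>J. y i = x i) \<longrightarrow> f y = f x)}"
    have "open A" unfolding A_def by (intro open_Union) (auto intro: open_cylinder)
    moreover have "A \<inter> C = f -` B \<inter> C"
    proof (intro equalityI subsetI)
      fix x assume "x \<in> A \<inter> C"
      then show "x \<in> f -` B \<inter> C" unfolding A_def by fastforce
    next
      fix x assume x: "x \<in> f -` B \<inter> C"
      with r obtain J where "finite J" "\<forall>y\<in>C. (\<forall>i\<in>J. y i = x i) \<longrightarrow> f y = f x" by blast
      with x show "x \<in> A \<inter> C" unfolding A_def
        by (intro IntI UnionI[of "{y. \<forall>i\<in>J. y i = x i}"]) blast+
    qed
    ultimately show "\<exists>A. open A \<and> A \<inter> C = f -` B \<inter> C" by blast
  qed
qed

lemma continuous_on_into_fun_bool_iff: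
  fixes f :: "'a :: topological_space \<Rightarrow> 'i \<Rightarrow> bool"
  shows "continuous_on C f \<longleftrightarrow> (\<forall>i. continuous_on C (\<lambda>x. f x i))"
  using continuous_on_coordinatewise_then_product[of C f] continuous_on_product_then_coordinatewise[of C f]
  by blast

lemma compact_UNIV_fun_bool: "compact (UNIV :: ('i \<Rightarrow> bool) set)"
proof -
  have "compact_space (euclidean :: bool topology)"
    unfolding compact_space_def by (simp add: finite_imp_compact)
  then have "compact_space (product_topology (\<lambda>_::'i. euclidean::bool topology) UNIV)"
    by (simp add: compact_space_product_topology)
  then show ?thesis by (simp add: compact_space_def euclidean_product_topology)
qed

text \<open>By compactness finitely many cylinders on which \<open>f\<close> is constant within
  \<open>C\<close> cover \<open>C\<close>; the union of their index sets serves all points at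
  once.\<close>

lemma continuous_on_closed_uniform:
  fixes f :: "('i \<Rightarrow> bool) \<Rightarrow> 'b :: discrete_topology"
  assumes "closed C" "continuous_on C f"
  obtains J where "finite J" "\<forall>x\<in>C. \<forall>y\<in>C. (\<forall>i\<in>J. y i = x i) \<longrightarrow> f y = f x"
proof -
  have C: "compact C" using compact_Int_closed[OF compact_UNIV_fun_bool assms(1)] by simp
  obtain J where J: "\<And>x. x \<in> C \<Longrightarrow> finite (J x)"
    "\<And>x y. x \<in> C \<Longrightarrow> y \<in> C \<Longrightarrow> \<forall>i\<in>J x. y i = x i \<Longrightarrow> f y = f x"
    using bchoice[OF assms(2)[unfolded continuous_on_fun_bool_iff]] by blast
  obtain D where D: "D \<subseteq> C" "finite D" "C \<subseteq> (\<Union>x\<in>D. {y. \<forall>i\<in>J x. y i = x i})"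
    by (rule compactE_image[OF C, of C "\<lambda>x. {y. \<forall>i\<in>J x. y i = x i}"])
      (auto intro: open_cylinder J(1))
  show thesis
  proof
    show "finite (\<Union>x\<in>D. J x)" using D J(1) by auto
    show "\<forall>x\<in>C. \<forall>y\<in>C. (\<forall>i\<in>(\<Union>x\<in>D. J x). y i = x i) \<longrightarrow> f y = f x"
    proof (intro ballI impI)
      fix x y assume xy: "x \<in> C" "y \<in> C" "\<forall>i\<in>(\<Union>x\<in>D. J x). y i = x i"
      with D obtain z where z: "z \<in> D" "\<forall>i\<in>J z. x i = z i" by blast
      with xy D(1) have "f x = f z" "f y = f z" by (auto intro!: J(2))
      then show "f y = f x" by simp
    qed
  qed
qed

lemma first_diff:
  assumes "x \<noteq> y"
  obtains n :: nat where "\<forall>i<n. y i = x i" "y n \<noteq> x n"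
proof -
  from assms have "\<exists>n. y n \<noteq> x n" by (metis ext)
  then show thesis using exists_least_iff[of "\<lambda>n. y n \<noteq> x n"] that by blast
qed

section \<open>Perfect subsets of the Cantor space\<close>

text \<open>These are the levels at which the path \<open>x\<close> meets a branching node in the
  tree of initial segments of points of \<open>C\<close>.\<close>

definition branch :: "(nat \<Rightarrow> bool) set \<Rightarrow> (nat \<Rightarrow> bool) \<Rightarrow> nat set" where
  "branch C x = {n. \<exists>y\<in>C. (\<forall>i<n. y i = x i) \<and> y n \<noteq> x n}"

text \<open>In this form it is visible that being the \<open>j\<close>-th element depends only on
  the part of \<open>S\<close> up to \<open>p\<close>.\<close>

lemma enumerate_eq_iff_card:
  fixes S :: "nat set"
  assumes "infinite S"
  shows "enumerate S j = p \<longleftrightarrow> p \<in> S \<and> card (S \<inter> {..<p}) = j"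
proof -
  have c: "card (S \<inter> {..<enumerate S j}) = j" for j
  proof -
    have "S \<inter> {..<enumerate S j} = enumerate S ` {..<j}"
    proof (intro equalityI subsetI)
      fix n assume "n \<in> S \<inter> {..<enumerate S j}"
      moreover then obtain i where "n = enumerate S i" using enumerate_Ex assms by blast
      ultimately show "n \<in> enumerate S ` {..<j}" using assms by (simp add: enumerate_mono_iff)
    next
      fix n assume "n \<in> enumerate S ` {..<j}"
      then show "n \<in> S \<inter> {..<enumerate S j}" using assms by (auto simp: enumerate_in_set enumerate_mono)
    qed
    moreover have "inj_on (enumerate S) {..<j}"
      using strict_mono_enumerate[OF assms] by (simp add: strict_mono_imp_inj_on inj_on_subset)
    ultimately show ?thesis by (simp add: card_image)
  qed
  show ?thesis
  proof
    assume "enumerate S j = p"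
    then show "p \<in> S \<and> card (S \<inter> {..<p}) = j" using c[of j] enumerate_in_set[OF assms, of j] by auto
  next
    assume p: "p \<in> S \<and> card (S \<inter> {..<p}) = j"
    then obtain i where "enumerate S i = p" using enumerate_Ex assms by blast
    with p c[of i] show "enumerate S j = p" by auto
  qed
qed

text \<open>Reading \<open>x\<close> only at its branching levels erases the forced bits and unfolds
  the tree of \<open>C\<close> into the full binary tree. Which levels up to \<open>p\<close> are
  branching depends only on the bits of \<open>x\<close> below \<open>p\<close>; this yields
  continuity in both directions.\<close>

lemma homeomorphism_perfect_cantor:
  fixes C :: "(nat \<Rightarrow> bool) set"
  assumes ne: "C \<noteq> {}" and cl: "closed C"
    and perf: "\<And>x J. x \<in> C \<Longrightarrow> finite J \<Longrightarrow> \<exists>y\<in>C. y \<noteq> x \<and> (\<forall>i\<in>J. y i = x i)"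
  obtains f g where "homeomorphism C UNIV f (g :: (nat \<Rightarrow> bool) \<Rightarrow> (nat \<Rightarrow> bool))"
proof -
  define B where "B = branch C"
  define f where "f x j = x (enumerate (B x) j)" for x and j :: nat
  have inf: "infinite (B x)" if "x \<in> C" for x
    unfolding infinite_nat_iff_unbounded_le
  proof
    fix m
    from perf[OF that, of "{..<m}"] obtain y where y: "y \<in> C" "y \<noteq> x" "\<forall>i<m. y i = x i" by auto
    then obtain n where n: "\<forall>i<n. y i = x i" "y n \<noteq> x n" using first_diff[of x y] by metis
    with y have "n \<in> B x" unfolding B_def branch_def by auto
    moreover have "m \<le> n" using y(3) n(2) not_le_imp_less by blast
    ultimately show "\<exists>n\<ge>m. n \<in> B x" by blast
  qed
  have B_cong: "B x \<inter> {..p} = B y \<inter> {..p}" if "\<forall>i<p. y i = x i" "x \<in> C" "y \<in> C" for x y p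
  proof -
    have "n \<in> B y" if "n \<le> p" "n \<in> B x" "\<forall>i<p. y i = x i" "x \<in> C" for x y n
    proof -
      from that obtain z where z: "z \<in> C" "\<forall>i<n. z i = x i" "z n \<noteq> x n" unfolding B_def branch_def by blast
      show ?thesis unfolding B_def branch_def
      proof (cases "y n = x n")
        case True
        then show "n \<in> {n. \<exists>ya\<in>C. (\<forall>i<n. ya i = y i) \<and> ya n \<noteq> y n}" using z that by auto
      next
        case False
        then show "n \<in> {n. \<exists>ya\<in>C. (\<forall>i<n. ya i = y i) \<and> ya n \<noteq> y n}" using z that by auto
      qed
    qed
    from this[of _ x y] this[of _ y x] that show ?thesis by auto
  qed
  have enum_cong: "enumerate (B y) j = p"
    if "\<forall>i<p. y i = x i" "x \<in> C" "y \<in> C" "enumerate (B x) j = p" for x y j p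
  proof -
    have "n \<in> B y \<longleftrightarrow> n \<in> B x" if "n \<le> p" for n
      using B_cong[OF \<open>\<forall>i<p. y i = x i\<close> \<open>x \<in> C\<close> \<open>y \<in> C\<close>] that by blast
    then have "B y \<inter> {..<p} = B x \<inter> {..<p}" "p \<in> B y \<longleftrightarrow> p \<in> B x"
      by auto
    with that show ?thesis by (simp add: enumerate_eq_iff_card inf)
  qed
  have agree: "y n = x n" if "x \<in> C" "y \<in> C" "\<forall>j\<le>n. f y j = f x j" for x y n
  proof (rule ccontr)
    assume *: "y n \<noteq> x n"
    \<comment> \<open>The first difference \<open>m\<close> is a branching level of both points with
      the same index \<open>j\<close>, so the images differ at \<open>j\<close>, where
      \<open>j \<le> m \<le> n\<close>.\<close>
    then obtain m where m: "\<forall>i<m. y i = x i" "y m \<noteq> x m" using first_diff[of x y] by metis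
    from m(1) * have "m \<le> n" using not_le_imp_less by blast
    have "m \<in> B x" using m that unfolding B_def branch_def by blast
    then obtain j where j: "enumerate (B x) j = m" using enumerate_Ex[OF inf[OF \<open>x \<in> C\<close>]] by metis
    then have "enumerate (B y) j = m" by (rule enum_cong[OF m(1) that(1,2)])
    with j m(2) have "f y j \<noteq> f x j" by (simp add: f_def)
    moreover have "j \<le> m" using le_enumerate[OF inf[OF that(1)], of j] j by simp
    ultimately show False using that(3) \<open>m \<le> n\<close> by auto
  qed
  have f_cong: "f y j = f x j" if "x \<in> C" "y \<in> C" "\<forall>i\<le>enumerate (B x) j. y i = x i" for x y j
    using enum_cong[of "enumerate (B x) j" y x j] that by (simp add: f_def)
  have cont: "continuous_on C f"
    unfolding continuous_on_into_fun_bool_iff continuous_on_fun_bool_iff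
  proof (intro allI ballI)
    fix j x assume "x \<in> C"
    then show "\<exists>J. finite J \<and> (\<forall>y\<in>C. (\<forall>i\<in>J. y i = x i) \<longrightarrow> f y j = f x j)"
      by (intro exI[of _ "{..enumerate (B x) j}"] conjI ballI impI f_cong) simp_all
  qed
  have approx: "\<exists>x\<in>C. \<forall>j<k. f x j = t j" for t k
  proof (induction k)
    case 0
    then show ?case using ne by auto
  next
    case (Suc k)
    then obtain x where x: "x \<in> C" "\<forall>j<k. f x j = t j" by blast
    \<comment> \<open>Leaving \<open>x\<close> at its \<open>k\<close>-th branching level flips the
      image at \<open>k\<close> and keeps the earlier values, so either \<open>x\<close> or
      \<open>y\<close> extends the approximation.\<close>
    define p where "p = enumerate (B x) k"
    have "p \<in> B x" unfolding p_def by (rule enumerate_in_set[OF inf[OF x(1)]])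
    then obtain y where y: "y \<in> C" "\<forall>i<p. y i = x i" "y p \<noteq> x p" unfolding B_def branch_def by blast
    have "enumerate (B y) k = p" using enum_cong[OF y(2) x(1) y(1)] p_def by simp
    with y have ne: "f y k \<noteq> f x k" by (simp add: f_def p_def)
    have "f y j = f x j" if "j < k" for j
    proof (rule f_cong)
      have "enumerate (B x) j < p" unfolding p_def by (rule enumerate_mono[OF that inf[OF x(1)]])
      then show "\<forall>i\<le>enumerate (B x) j. y i = x i" using y(2) by auto
    qed (use x y in auto)
    with ne x y show ?case by (metis less_Suc_eq)
  qed
  have surj: "\<exists>x\<in>C. f x = t" for t
  proof -
    have "\<forall>k. \<exists>x. x \<in> C \<and> (\<forall>j<k. f x j = t j)" using approx[of _ t] by blast
    then obtain X where X: "\<And>k. X k \<in> C" "\<And>k j. j < k \<Longrightarrow> f (X k) j = t j"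
      unfolding choice_iff by blast
    have XX: "X k n = X l n" if "n < k" "n < l" for k l n
      by (rule agree) (use X that in auto)
    \<comment> \<open>By \<open>agree\<close> the coordinate \<open>n\<close> of \<open>X k\<close>
      no longer changes once \<open>k > n\<close>, so this is the pointwise limit of the
      approximants.\<close>
    define x where "x n = X (Suc n) n" for n
    have xX: "x n = X k n" if "n < k" for n k
      unfolding x_def using XX[of n "Suc n" k] that by simp
    have "x \<in> closure C" unfolding closure_fun_bool_iff
    proof (intro allI impI)
      fix J :: "nat set" assume "finite J"
      then obtain k where "\<forall>i\<in>J. i < k" by (meson finite_nat_set_iff_bounded)
      then show "\<exists>y\<in>C. \<forall>i\<in>J. y i = x i" by (intro bexI[OF _ X(1)[of k]]) (metis xX)
    qed
    then have "x \<in> C" using cl by simp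
    moreover have "f x j = t j" for j
    proof -
      define k where "k = Suc (max j (enumerate (B x) j))"
      have "\<forall>i\<le>enumerate (B x) j. X k i = x i"
      proof (intro allI impI)
        fix i assume "i \<le> enumerate (B x) j"
        then show "X k i = x i" using xX[of i k] by (simp add: k_def)
      qed
      then have "f (X k) j = f x j" by (intro f_cong X(1) \<open>x \<in> C\<close>)
      moreover have "f (X k) j = t j" using X(2) by (simp add: k_def)
      ultimately show ?thesis by simp
    qed
    ultimately show ?thesis by blast
  qed
  have inj: "inj_on f C"
  proof (rule inj_onI, rule ext)
    fix x y n assume "x \<in> C" "y \<in> C" "f x = f y"
    then show "x n = y n" using agree[of y x n] by simp
  qed
  define g where "g = the_inv_into C f"
  have "t \<in> f ` C" for t using surj[of t] by (auto simp: image_iff)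
  then have img: "f ` C = UNIV" by auto
  have g: "g t \<in> C" "f (g t) = t" for t
    using img inj the_inv_into_into[of f C t C] f_the_inv_into_f[of f C t] unfolding g_def by auto
  have gf: "g (f x) = x" if "x \<in> C" for x using inj that unfolding g_def by (simp add: the_inv_into_f_f)
  have "continuous_on UNIV g"
    unfolding continuous_on_into_fun_bool_iff continuous_on_fun_bool_iff
  proof (intro allI ballI)
    fix n x
    show "\<exists>J. finite J \<and> (\<forall>y\<in>UNIV. (\<forall>i\<in>J. y i = x i) \<longrightarrow> g y n = g x n)"
      by (intro exI[of _ "{..n}"] conjI ballI impI agree) (simp_all add: g)
  qed
  moreover have "range g = C" using g(1) gf by (metis (no_types) UNIV_I image_eqI image_subsetI subsetI subset_antisym)
  ultimately have "homeomorphism C UNIV f g"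
    unfolding homeomorphism_def using cont g gf img by simp
  then show thesis by (rule that)
qed

section \<open>Finite subgroups of the topological full group and coboundaries\<close>

lemma continuous_on_fun_boolE:
  fixes f :: "('i \<Rightarrow> bool) \<Rightarrow> 'b :: discrete_topology"
  assumes "continuous_on C f" "x \<in> C"
  obtains J where "finite J" "\<forall>y\<in>C. (\<forall>i\<in>J. y i = x i) \<longrightarrow> f y = f x"
proof -
  have "\<exists>J. finite J \<and> (\<forall>y\<in>C. (\<forall>i\<in>J. y i = x i) \<longrightarrow> f y = f x)"
    by (rule bspec[OF assms(1)[unfolded continuous_on_fun_bool_iff] assms(2)])
  then show thesis by (elim exE conjE) (rule that)
qed

lemma continuous_on_discrete_combine:
  fixes f :: "('i \<Rightarrow> bool) \<Rightarrow> 'a :: discrete_topology" and g :: "('i \<Rightarrow> bool) \<Rightarrow> 'b :: discrete_topology"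
    and H :: "'a \<Rightarrow> 'b \<Rightarrow> 'c :: discrete_topology"
  assumes "continuous_on C f" "continuous_on C g"
  shows "continuous_on C (\<lambda>x. H (f x) (g x))"
  unfolding continuous_on_fun_bool_iff
proof
  fix x assume x: "x \<in> C"
  obtain J where J: "finite J" "\<forall>y\<in>C. (\<forall>i\<in>J. y i = x i) \<longrightarrow> f y = f x"
    by (rule continuous_on_fun_boolE[OF assms(1) x])
  obtain K where K: "finite K" "\<forall>y\<in>C. (\<forall>i\<in>K. y i = x i) \<longrightarrow> g y = g x"
    by (rule continuous_on_fun_boolE[OF assms(2) x])
  show "\<exists>J. finite J \<and> (\<forall>y\<in>C. (\<forall>i\<in>J. y i = x i) \<longrightarrow> H (f y) (g y) = H (f x) (g x))"
  proof (intro exI[of _ "J \<union> K"] conjI ballI impI)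
    fix y assume y: "y \<in> C" "\<forall>i\<in>J \<union> K. y i = x i"
    have "f y = f x" using bspec[OF J(2) y(1)] y(2) by blast
    moreover have "g y = g x" using bspec[OF K(2) y(1)] y(2) by blast
    ultimately show "H (f y) (g y) = H (f x) (g x)" by simp
  qed (use J(1) K(1) in simp)
qed

lemma continuous_on_Ball:
  fixes p :: "'s \<Rightarrow> ('i \<Rightarrow> bool) \<Rightarrow> bool"
  assumes "finite S" "\<And>s. s \<in> S \<Longrightarrow> continuous_on C (p s)"
  shows "continuous_on C (\<lambda>x. \<forall>s\<in>S. p s x)"
  using assms
proof (induction S rule: finite_induct)
  case (insert s S)
  then show ?case
    using continuous_on_discrete_combine[of C "p s" "\<lambda>x. \<forall>s\<in>S. p s x" "(\<and>)"] by simp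
qed simp

lemma less_fun_total:
  assumes "x \<noteq> y"
  shows "less_fun x y \<or> less_fun y (x :: nat \<Rightarrow> bool)"
proof -
  from assms obtain n where "\<forall>i<n. y i = x i" "y n \<noteq> x n" by (rule first_diff)
  then show ?thesis unfolding less_fun_def by (cases "x n") auto
qed

lemma ex_less_fun_min:
  assumes "finite S" "S \<noteq> {}"
  obtains m :: "nat \<Rightarrow> bool" where "m \<in> S" "\<forall>x\<in>S. \<not> less_fun x m"
proof -
  have "\<exists>m\<in>S. \<forall>x\<in>S. x \<noteq> m \<longrightarrow> \<not> less_fun x m"
    by (rule Finite_Set.bex_min_element[OF assms(1) _ _ assms(2)])
      (auto simp: asymp_on_def transp_on_def dest: less_fun_asym intro: less_fun_trans)
  then show thesis using that less_fun_irrefl by metis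
qed

section \<open>Free actions and coboundaries of integer valued functions\<close>

lemma Z2_action_add: "Z2_action \<alpha> \<Longrightarrow> \<alpha> (\<gamma> + \<delta>) x = \<alpha> \<gamma> (\<alpha> \<delta> x)"
proof -
  assume "Z2_action \<alpha>"
  then have "\<forall>a b c d. \<alpha> (a + c, b + d) = \<alpha> (a, b) \<circ> \<alpha> (c, d)" unfolding Z2_action_def by blast
  from this[rule_format, of "fst \<gamma>" "fst \<delta>" "snd \<gamma>" "snd \<delta>"] show ?thesis
    by (simp add: plus_prod_def)
qed

lemma Z2_action_zero: "Z2_action \<alpha> \<Longrightarrow> \<alpha> 0 x = x"
  unfolding Z2_action_def zero_prod_def by (metis id_apply)

lemma Z2_action_minus:
  assumes "Z2_action \<alpha>"
  shows "\<alpha> (- \<gamma>) (\<alpha> \<gamma> x) = x" "\<alpha> \<gamma> (\<alpha> (- \<gamma>) x) = x"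
  using Z2_action_add[OF assms, of "-\<gamma>" \<gamma> x] Z2_action_add[OF assms, of \<gamma> "-\<gamma>" x]
    Z2_action_zero[OF assms] by simp_all

lemma free_action_inj:
  assumes "Z2_action \<alpha>" "free_action \<alpha>" "\<alpha> \<gamma> x = \<alpha> \<delta> x"
  shows "\<gamma> = \<delta>"
proof -
  have "\<alpha> (-\<delta> + \<gamma>) x = x" by (metis Z2_action_add Z2_action_minus(1) assms(1,3))
  then have "-\<delta> + \<gamma> = 0" using assms(2) unfolding free_action_def zero_prod_def by blast
  then show ?thesis by (simp add: algebra_simps)
qed

lemma Z2_action_continuous: "Z2_action \<alpha> \<Longrightarrow> continuous_on UNIV (\<alpha> \<gamma>)"
  unfolding Z2_action_def by blast

definition coboundary :: "(int \<times> int \<Rightarrow> cantor \<Rightarrow> cantor) \<Rightarrow> (cantor \<Rightarrow> int) \<Rightarrow> bool" where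
  "coboundary \<alpha> k \<longleftrightarrow> (\<exists>u v. continuous_on UNIV u \<and> continuous_on UNIV v \<and>
     (\<forall>x. k x = (u (\<alpha> (0, 1) x) - u x) + (v (\<alpha> (1, 0) x) - v x)))"

lemma coboundary_zero: "coboundary \<alpha> (\<lambda>_. 0)"
  unfolding coboundary_def by (intro exI[of _ "\<lambda>_. 0"]) simp

lemma coboundary_add:
  assumes "coboundary \<alpha> k" "coboundary \<alpha> l"
  shows "coboundary \<alpha> (\<lambda>x. k x + l x)"
proof -
  from assms obtain u v u' v' where
    "continuous_on UNIV u" "continuous_on UNIV v"
    "\<And>x. k x = (u (\<alpha> (0, 1) x) - u x) + (v (\<alpha> (1, 0) x) - v x)"
    "continuous_on UNIV u'" "continuous_on UNIV v'"
    "\<And>x. l x = (u' (\<alpha> (0, 1) x) - u' x) + (v' (\<alpha> (1, 0) x) - v' x)"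
    unfolding coboundary_def by metis
  then show ?thesis unfolding coboundary_def
    by (intro exI[of _ "\<lambda>x. u x + u' x"] exI[of _ "\<lambda>x. v x + v' x"] conjI
        continuous_on_discrete_combine[where H = "(+)"]) auto
qed

lemma coboundary_minus:
  assumes "coboundary \<alpha> k"
  shows "coboundary \<alpha> (\<lambda>x. - k x)"
proof -
  from assms obtain u v where uv:
    "continuous_on UNIV u" "continuous_on UNIV v"
    "\<And>x. k x = (u (\<alpha> (0, 1) x) - u x) + (v (\<alpha> (1, 0) x) - v x)"
    unfolding coboundary_def by metis
  have "continuous_on UNIV (\<lambda>x. - u x)" "continuous_on UNIV (\<lambda>x. - v x)"
    using continuous_on_discrete_combine[OF uv(1,1), of "\<lambda>a _. - a"]
      continuous_on_discrete_combine[OF uv(2,2), of "\<lambda>a _. - a"] by auto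
  with uv(3) show ?thesis unfolding coboundary_def
    by (intro exI[of _ "\<lambda>x. - u x"] exI[of _ "\<lambda>x. - v x"]) simp
qed

lemma coboundary_sum:
  assumes "\<And>i. i \<in> I \<Longrightarrow> coboundary \<alpha> (k i)"
  shows "coboundary \<alpha> (\<lambda>x. \<Sum>i\<in>I. k i x)"
  using assms
proof (induction I rule: infinite_finite_induct)
  case (insert i I)
  then show ?case using coboundary_add[of \<alpha> "k i" "\<lambda>x. \<Sum>i\<in>I. k i x"] by simp
qed (simp_all add: coboundary_zero)

text \<open>The group elements for which this holds for all continuous \<open>k\<close> contain both
  generators and are closed under sums (by telescoping) and negation (by substitution).\<close>

lemma coboundary_translate:
  assumes act: "Z2_action \<alpha>" and k: "continuous_on UNIV k"
  shows "coboundary \<alpha> (\<lambda>x. k (\<alpha> \<gamma> x) - k x)"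
proof -
  define G where "G = {\<gamma>. \<forall>k. continuous_on UNIV k \<longrightarrow> coboundary \<alpha> (\<lambda>x. k (\<alpha> \<gamma> x) - k x)}"
  note cont = Z2_action_continuous[OF act]
  have comp: "continuous_on UNIV (\<lambda>x. k (\<alpha> \<gamma> x))" if "continuous_on UNIV k" for k :: "cantor \<Rightarrow> int" and \<gamma>
    by (rule continuous_on_compose2[OF that cont]) simp
  have add: "\<gamma> + \<delta> \<in> G" if "\<gamma> \<in> G" "\<delta> \<in> G" for \<gamma> \<delta>
    unfolding G_def
  proof (intro CollectI allI impI)
    fix k :: "cantor \<Rightarrow> int" assume k: "continuous_on UNIV k"
    have "coboundary \<alpha> (\<lambda>x. (k (\<alpha> \<gamma> (\<alpha> \<delta> x)) - k (\<alpha> \<gamma> x)) + (k (\<alpha> \<gamma> x) - k x))"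
      by (rule coboundary_add) (use that k comp[OF k, of \<gamma>] in \<open>auto simp: G_def\<close>)
    then show "coboundary \<alpha> (\<lambda>x. k (\<alpha> (\<gamma> + \<delta>) x) - k x)" by (simp add: Z2_action_add[OF act])
  qed
  have minus: "- \<gamma> \<in> G" if "\<gamma> \<in> G" for \<gamma>
    unfolding G_def
  proof (intro CollectI allI impI)
    fix k :: "cantor \<Rightarrow> int" assume k: "continuous_on UNIV k"
    have "coboundary \<alpha> (\<lambda>x. k (\<alpha> (-\<gamma>) (\<alpha> \<gamma> x)) - k (\<alpha> (-\<gamma>) x))"
      using that comp[OF k, of "-\<gamma>"] by (auto simp: G_def)
    then have "coboundary \<alpha> (\<lambda>x. k x - k (\<alpha> (-\<gamma>) x))" by (simp add: Z2_action_minus[OF act])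
    from coboundary_minus[OF this] show "coboundary \<alpha> (\<lambda>x. k (\<alpha> (-\<gamma>) x) - k x)" by simp
  qed
  have gen: "(1, 0) \<in> G" "(0, 1) \<in> G"
  proof -
    show "(1, 0) \<in> G" unfolding G_def coboundary_def
    proof (intro CollectI allI impI)
      fix k :: "cantor \<Rightarrow> int" assume "continuous_on UNIV k"
      then show "\<exists>u v. continuous_on UNIV u \<and> continuous_on UNIV v \<and> (\<forall>x. k (\<alpha> (1, 0) x) - k x =
        u (\<alpha> (0, 1) x) - u x + (v (\<alpha> (1, 0) x) - v x))"
        by (intro exI[of _ "\<lambda>_. 0"] exI[of _ k]) simp
    qed
    show "(0, 1) \<in> G" unfolding G_def coboundary_def
    proof (intro CollectI allI impI)
      fix k :: "cantor \<Rightarrow> int" assume "continuous_on UNIV k"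
      then show "\<exists>u v. continuous_on UNIV u \<and> continuous_on UNIV v \<and> (\<forall>x. k (\<alpha> (0, 1) x) - k x =
        u (\<alpha> (0, 1) x) - u x + (v (\<alpha> (1, 0) x) - v x))"
        by (intro exI[of _ k] exI[of _ "\<lambda>_. 0"]) simp
    qed
  qed
  have zero: "(0, 0) \<in> G" using add[OF gen(1) minus[OF gen(1)]] by simp
  have "(a, 0) \<in> G" for a
  proof (induction a rule: int_induct[of _ 0])
    case (step1 i)
    then show ?case using add[OF _ gen(1), of "(i, 0)"] by simp
  next
    case (step2 i)
    then show ?case using add[OF _ minus[OF gen(1)], of "(i, 0)"] by simp
  qed (rule zero)
  moreover have "(0, b) \<in> G" for b
  proof (induction b rule: int_induct[of _ 0])
    case (step1 i)
    then show ?case using add[OF _ gen(2), of "(0, i)"] by simp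
  next
    case (step2 i)
    then show ?case using add[OF _ minus[OF gen(2)], of "(0, i)"] by simp
  qed (rule zero)
  ultimately have "\<gamma> \<in> G" using add[of "(fst \<gamma>, 0)" "(0, snd \<gamma>)"] by simp
  then show ?thesis using k by (simp add: G_def)
qed

section \<open>Clopen sets attached to elements of the full group\<close>

text \<open>Off the fixed points the first difference between \<open>f x\<close> and
  \<open>x\<close> decides the comparison and persists nearby. Near a fixed point every point is
  fixed, because the fixed point set is clopen, and the comparison is false throughout.\<close>

lemma continuous_on_less_fun:
  fixes f :: "(nat \<Rightarrow> bool) \<Rightarrow> nat \<Rightarrow> bool"
  assumes f: "continuous_on UNIV f" and fixed: "continuous_on UNIV (\<lambda>x. f x = x)"
  shows "continuous_on UNIV (\<lambda>x. less_fun (f x) x)"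
  unfolding continuous_on_fun_bool_iff
proof
  fix x :: "nat \<Rightarrow> bool"
  show "\<exists>J. finite J \<and> (\<forall>y\<in>UNIV. (\<forall>i\<in>J. y i = x i) \<longrightarrow> less_fun (f y) y = less_fun (f x) x)"
  proof (cases "f x = x")
    case True
    obtain J where J: "finite J" "\<forall>y\<in>UNIV. (\<forall>i\<in>J. y i = x i) \<longrightarrow> (f y = y) = (f x = x)"
      by (rule continuous_on_fun_boolE[OF fixed UNIV_I[of x]])
    show ?thesis
    proof (intro exI[of _ J] conjI ballI impI)
      fix y assume "\<forall>i\<in>J. y i = x i"
      then have "f y = y" using bspec[OF J(2), of y] True by simp
      with True show "less_fun (f y) y = less_fun (f x) x" by (simp add: less_fun_irrefl)
    qed (rule J(1))
  next
    case False
    then obtain n where n: "\<forall>i<n. x i = f x i" "x n \<noteq> f x n" using first_diff[of "f x" x] by metis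
    have *: "continuous_on UNIV (\<lambda>y. f y i = f x i)" for i
      using continuous_on_discrete_combine[of UNIV "\<lambda>y. f y i" "\<lambda>y. f y i" "\<lambda>a b. a = f x i"] f
      by (simp add: continuous_on_into_fun_bool_iff)
    have "continuous_on UNIV (\<lambda>y. \<forall>i\<in>{..n}. f y i = f x i)"
      by (rule continuous_on_Ball) (use * in auto)
    then obtain J where J: "finite J" "\<forall>y\<in>UNIV. (\<forall>i\<in>J. y i = x i) \<longrightarrow>
        (\<forall>i\<in>{..n}. f y i = f x i) = (\<forall>i\<in>{..n}. f x i = f x i)"
      by (rule continuous_on_fun_boolE[OF _ UNIV_I[of x]])
    have less_iff: "less_fun a b \<longleftrightarrow> \<not> a n \<and> b n" if "\<forall>i<n. b i = a i" "b n \<noteq> a n" for a b :: "nat \<Rightarrow> bool"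
    proof
      assume "less_fun a b"
      then obtain k where k: "a k < b k" "\<forall>k'<k. a k' = b k'" unfolding less_fun_def by blast
      with that have "k = n" by (cases k n rule: linorder_cases) auto
      with k show "\<not> a n \<and> b n" by simp
    next
      assume "\<not> a n \<and> b n"
      with that show "less_fun a b" by (intro less_funI exI[of _ n]) auto
    qed
    show ?thesis
    proof (intro exI[of _ "J \<union> {..n}"] conjI ballI impI)
      fix y assume y: "\<forall>i\<in>J \<union> {..n}. y i = x i"
      then have "\<forall>i\<le>n. f y i = f x i" "\<forall>i\<le>n. y i = x i" using bspec[OF J(2), of y] by simp_all
      with n show "less_fun (f y) y = less_fun (f x) x" by (simp add: less_iff)
    qed (use J(1) in auto)
  qed
qed

lemma TFG_homeo:
  assumes "f \<in> TFG \<alpha>"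
  shows "continuous_on UNIV f" "bij f"
proof -
  from assms obtain g where "homeomorphism UNIV UNIV f g" unfolding TFG_def Homeo_def by blast
  then show "continuous_on UNIV f" "bij f"
    unfolding homeomorphism_def by (auto intro!: o_bij[of g] simp: fun_eq_iff)
qed

text \<open>By freeness the group element taking \<open>x\<close> to \<open>f x\<close> is unique,
  so on each piece of the partition the equation \<open>f y = \<alpha> \<delta> y\<close> holds
  everywhere or nowhere.\<close>

lemma TFG_cocycle:
  assumes act: "Z2_action \<alpha>" "free_action \<alpha>" and f: "f \<in> TFG \<alpha>"
  shows "\<exists>\<Gamma>. finite \<Gamma> \<and> (\<forall>x. \<exists>\<delta>\<in>\<Gamma>. f x = \<alpha> \<delta> x)"
    and "continuous_on UNIV (\<lambda>x. f x = \<alpha> \<delta> x)"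
proof -
  from f obtain \<P> \<gamma> where P: "clopen_partition \<P>" "\<And>A x. A \<in> \<P> \<Longrightarrow> x \<in> A \<Longrightarrow> f x = \<alpha> (\<gamma> A) x"
    unfolding TFG_def by blast
  then have fin: "finite \<P>" and cov: "\<And>x. \<exists>A\<in>\<P>. x \<in> A" and op: "\<And>A. A \<in> \<P> \<Longrightarrow> open A"
    unfolding clopen_partition_def by auto
  show "\<exists>\<Gamma>. finite \<Gamma> \<and> (\<forall>x. \<exists>\<delta>\<in>\<Gamma>. f x = \<alpha> \<delta> x)"
    by (intro exI[of _ "\<gamma> ` \<P>"] conjI finite_imageI fin allI) (use cov P(2) in blast)
  show "continuous_on UNIV (\<lambda>x. f x = \<alpha> \<delta> x)"
    unfolding continuous_on_fun_bool_iff
  proof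
    fix x
    from cov obtain A where A: "A \<in> \<P>" "x \<in> A" by blast
    with op obtain J where J: "finite J" "{y. \<forall>i\<in>J. y i = x i} \<subseteq> A"
      unfolding open_fun_bool_iff by blast
    have "(f y = \<alpha> \<delta> y) = (\<gamma> A = \<delta>)" if "y \<in> A" for y
      using P(2)[OF A(1) that] free_action_inj[OF act, of "\<gamma> A" y \<delta>] by auto
    with J A(2) show "\<exists>J. finite J \<and> (\<forall>y\<in>UNIV. (\<forall>i\<in>J. y i = x i) \<longrightarrow> (f y = \<alpha> \<delta> y) = (f x = \<alpha> \<delta> x))"
      by (intro exI[of _ J]) auto
  qed
qed

text \<open>The set \<open>D\<close> of lexicographically least points of the \<open>F\<close>-orbits is a clopen fundamental
  domain, and moving each value of \<open>h\<close> to the point of \<open>D\<close> in its orbit changes \<open>h\<close> by a coboundary.\<close>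

lemma finite_subgroup_coboundary:
  assumes act: "Z2_action \<alpha>" "free_action \<alpha>"
    and F: "finite F" "is_subgroup F" "F \<subseteq> TFG \<alpha>"
    and h: "continuous_on UNIV h" and zero: "\<And>x. (\<Sum>y\<in>(\<lambda>f. f x) ` F. h y) = 0"
  shows "coboundary \<alpha> h"
proof -
  define Orb where "Orb x = (\<lambda>f. f x) ` F" for x
  define D where "D = {x. \<forall>f\<in>F. \<not> less_fun (f x) x}"
  have idF: "id \<in> F" and compF: "\<And>f g. f \<in> F \<Longrightarrow> g \<in> F \<Longrightarrow> f \<circ> g \<in> F" and invF: "\<And>f. f \<in> F \<Longrightarrow> inv f \<in> F"
    using F(2) unfolding is_subgroup_def by auto
  have invf: "inv f (f x) = x" if "f \<in> F" for f x
    using TFG_homeo(2)[of f \<alpha>] F(3) that by (meson bij_is_inj inv_f_f subsetD)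
  have O_sym: "y \<in> Orb x \<longleftrightarrow> x \<in> Orb y" for x y
  proof -
    have "x \<in> Orb y" if y: "y \<in> Orb x" for x y
    proof -
      from y obtain f where "f \<in> F" "y = f x" unfolding Orb_def by blast
      then show "x \<in> Orb y" unfolding Orb_def using invF invf by (metis image_eqI)
    qed
    then show ?thesis by blast
  qed
  have O_trans: "z \<in> Orb x" if yz: "y \<in> Orb x" "z \<in> Orb y" for x y z
  proof -
    from yz obtain f g where "f \<in> F" "y = f x" "g \<in> F" "z = g y" unfolding Orb_def by blast
    then show ?thesis unfolding Orb_def using compF[of g f] by (intro image_eqI[of _ _ "g \<circ> f"]) auto
  qed
  have O_self: "x \<in> Orb x" for x unfolding Orb_def using idF by (intro image_eqI[of _ _ id]) auto
  have finO: "finite (Orb x)" for x unfolding Orb_def using F(1) by simp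
  have D_iff: "x \<in> D \<longleftrightarrow> (\<forall>y\<in>Orb x. \<not> less_fun y x)" for x unfolding D_def Orb_def by auto
  have D_ex: "\<exists>y\<in>Orb x. y \<in> D" for x
  proof -
    obtain m where m: "m \<in> Orb x" "\<forall>y\<in>Orb x. \<not> less_fun y m"
      using ex_less_fun_min[OF finO[of x]] O_self by blast
    moreover have "Orb m \<subseteq> Orb x" using O_trans m(1) by blast
    ultimately show ?thesis unfolding D_iff by blast
  qed
  have D_uniq: "y = z" if "y \<in> Orb x" "y \<in> D" "z \<in> Orb x" "z \<in> D" for x y z
  proof (rule ccontr)
    assume "y \<noteq> z"
    moreover have "y \<in> Orb z" "z \<in> Orb y" using that O_sym O_trans by blast+
    ultimately show False using less_fun_total that(2,4) unfolding D_iff by blast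
  qed
  have "\<forall>f\<in>F. \<exists>\<Gamma>. finite \<Gamma> \<and> (\<forall>x. \<exists>\<delta>\<in>\<Gamma>. f x = \<alpha> \<delta> x)" using TFG_cocycle(1)[OF act] F(3) by blast
  then obtain \<Gamma>' where G': "\<And>f. f \<in> F \<Longrightarrow> finite (\<Gamma>' f)" "\<And>f x. f \<in> F \<Longrightarrow> \<exists>\<delta>\<in>\<Gamma>' f. f x = \<alpha> \<delta> x"
    by metis
  define \<Gamma> where "\<Gamma> = (\<Union>f\<in>F. \<Gamma>' f)"
  have G: "finite \<Gamma>" using F(1) G'(1) unfolding \<Gamma>_def by blast
  have OG: "\<exists>\<delta>\<in>\<Gamma>. y = \<alpha> \<delta> x" if y: "y \<in> Orb x" for x y
  proof -
    from y obtain f where "f \<in> F" "y = f x" unfolding Orb_def by blast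
    with G'(2)[of f x] show ?thesis unfolding \<Gamma>_def by blast
  qed
  \<comment> \<open>\<open>E \<delta> x\<close> says that \<open>\<delta>\<close> moves
    \<open>x\<close> to the point of \<open>D\<close> in its orbit; by freeness and uniqueness of
    that point, exactly one \<open>\<delta>\<close> in \<open>\<Gamma>\<close> does so.\<close>
  define E where "E \<delta> x \<longleftrightarrow> \<alpha> \<delta> x \<in> Orb x \<and> \<alpha> \<delta> x \<in> D" for \<delta> x
  have cont_D: "continuous_on UNIV (\<lambda>x. x \<in> D)"
  proof -
    have "continuous_on UNIV (\<lambda>x. \<not> less_fun (f x) x)" if "f \<in> F" for f
    proof -
      have "f \<in> TFG \<alpha>" using that F(3) by blast
      \<comment> \<open>The case of the neutral group element says that the fixed point set of
        \<open>f\<close> is clopen.\<close>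
      then have "continuous_on UNIV (\<lambda>x. f x = \<alpha> 0 x)" "continuous_on UNIV f"
        using TFG_cocycle(2)[OF act] TFG_homeo by blast+
      then have "continuous_on UNIV (\<lambda>x. less_fun (f x) x)"
        by (intro continuous_on_less_fun) (simp_all add: Z2_action_zero[OF act(1)])
      from continuous_on_discrete_combine[OF this this, of "\<lambda>a _. \<not> a"] show ?thesis .
    qed
    then have "continuous_on UNIV (\<lambda>x. \<forall>f\<in>F. \<not> less_fun (f x) x)"
      by (rule continuous_on_Ball[OF F(1)])
    then show ?thesis unfolding D_def by simp
  qed
  have cont_E: "continuous_on UNIV (E \<delta>)" for \<delta>
  proof -
    have "continuous_on UNIV (\<lambda>x. f x \<noteq> \<alpha> \<delta> x)" if "f \<in> F" for f
    proof -
      have "continuous_on UNIV (\<lambda>x. f x = \<alpha> \<delta> x)" using TFG_cocycle(2)[OF act] F(3) that by blast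
      from continuous_on_discrete_combine[OF this this, of "\<lambda>a _. \<not> a"] show ?thesis .
    qed
    then have 1: "continuous_on UNIV (\<lambda>x. \<forall>f\<in>F. f x \<noteq> \<alpha> \<delta> x)" by (rule continuous_on_Ball[OF F(1)])
    have 2: "continuous_on UNIV (\<lambda>x. \<alpha> \<delta> x \<in> D)"
      by (rule continuous_on_compose2[OF cont_D Z2_action_continuous[OF act(1)]]) simp
    have "E \<delta> = (\<lambda>x. \<not> (\<forall>f\<in>F. f x \<noteq> \<alpha> \<delta> x) \<and> \<alpha> \<delta> x \<in> D)"
      unfolding E_def Orb_def image_iff by (rule ext) metis
    with continuous_on_discrete_combine[OF 1 2, of "\<lambda>a b. \<not> a \<and> b"] show ?thesis by simp
  qed
  \<comment> \<open>Translating \<open>k \<delta>\<close> by \<open>\<delta>\<close> places its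
    values on \<open>D\<close>. Summed over \<open>\<Gamma>\<close>, the functions
    \<open>k \<delta>\<close> give \<open>h\<close>, while their translates give at a point of
    \<open>D\<close> the sum of \<open>h\<close> over its orbit, which is zero, and vanish off
    \<open>D\<close>.\<close>
  define k where "k \<delta> x = (if E \<delta> x then h x else 0)" for \<delta> x
  have cont_k: "continuous_on UNIV (k \<delta>)" for \<delta>
    using continuous_on_discrete_combine[OF cont_E[of \<delta>] h, of "\<lambda>a b. if a then b else 0"]
    unfolding k_def by simp
  have "coboundary \<alpha> (\<lambda>x. k \<delta> x - k \<delta> (\<alpha> (-\<delta>) x))" for \<delta>
  proof -
    have "continuous_on UNIV (\<lambda>x. k \<delta> (\<alpha> (-\<delta>) x))"
      by (rule continuous_on_compose2[OF cont_k Z2_action_continuous[OF act(1)]]) simp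
    from coboundary_translate[OF act(1) this, of \<delta>] show ?thesis
      by (simp add: Z2_action_minus[OF act(1)])
  qed
  then have cob: "coboundary \<alpha> (\<lambda>x. \<Sum>\<delta>\<in>\<Gamma>. k \<delta> x - k \<delta> (\<alpha> (-\<delta>) x))" by (rule coboundary_sum)
  have sum_h: "(\<Sum>\<delta>\<in>\<Gamma>. k \<delta> x) = h x" for x
  proof -
    obtain y where y: "y \<in> Orb x" "y \<in> D" using D_ex by blast
    with OG obtain \<delta> where d: "\<delta> \<in> \<Gamma>" "y = \<alpha> \<delta> x" by blast
    have "E \<delta>' x \<longleftrightarrow> \<delta>' = \<delta>" for \<delta>'
      unfolding E_def using D_uniq[of "\<alpha> \<delta>' x" x y] y d free_action_inj[OF act, of \<delta>' x \<delta>] by auto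
    then have "(\<Sum>\<delta>\<in>\<Gamma>. k \<delta> x) = (\<Sum>\<delta>'\<in>\<Gamma>. if \<delta>' = \<delta> then h x else 0)" unfolding k_def by simp
    with G d(1) show ?thesis by simp
  qed
  have sum_0: "(\<Sum>\<delta>\<in>\<Gamma>. k \<delta> (\<alpha> (-\<delta>) x)) = 0" for x
  proof (cases "x \<in> D")
    case True
    have "bij_betw (\<lambda>\<delta>. \<alpha> (-\<delta>) x) {\<delta>\<in>\<Gamma>. \<alpha> (-\<delta>) x \<in> Orb x} (Orb x)"
      unfolding bij_betw_def
    proof (intro conjI inj_onI equalityI subsetI)
      fix \<delta> \<delta>' assume "\<alpha> (-\<delta>) x = \<alpha> (-\<delta>') x"
      then show "\<delta> = \<delta>'" using free_action_inj[OF act] by fastforce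
    next
      fix y assume y: "y \<in> Orb x"
      then obtain \<delta> where d: "\<delta> \<in> \<Gamma>" "x = \<alpha> \<delta> y" using OG O_sym by blast
      then have "y = \<alpha> (-\<delta>) x" using Z2_action_minus(1)[OF act(1)] by simp
      with d(1) y show "y \<in> (\<lambda>\<delta>. \<alpha> (-\<delta>) x) ` {\<delta>\<in>\<Gamma>. \<alpha> (-\<delta>) x \<in> Orb x}" by blast
    qed auto
    then have "(\<Sum>\<delta>\<in>{\<delta>\<in>\<Gamma>. \<alpha> (-\<delta>) x \<in> Orb x}. h (\<alpha> (-\<delta>) x)) = (\<Sum>y\<in>Orb x. h y)"
      by (rule sum.reindex_bij_betw)
    also have "\<dots> = 0" using zero unfolding Orb_def .
    also have "(\<Sum>\<delta>\<in>{\<delta>\<in>\<Gamma>. \<alpha> (-\<delta>) x \<in> Orb x}. h (\<alpha> (-\<delta>) x)) = (\<Sum>\<delta>\<in>\<Gamma>. k \<delta> (\<alpha> (-\<delta>) x))"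
      unfolding sum.inter_filter[OF G]
      by (rule sum.cong) (use True O_sym in \<open>auto simp: k_def E_def Z2_action_minus[OF act(1)]\<close>)
    finally show ?thesis .
  next
    case False
    then show ?thesis by (simp add: k_def E_def Z2_action_minus[OF act(1)])
  qed
  show ?thesis using cob by (simp add: sum_subtractf sum_h sum_0)
qed

section \<open>From a dense locally finite subgroup to an integral lift\<close>

lemma is_subgroup_generated:
  assumes "is_subgroup H" "S \<subseteq> H"
  shows "is_subgroup (generated_subgroup S)" "generated_subgroup S \<subseteq> H" "S \<subseteq> generated_subgroup S"
proof -
  show H: "generated_subgroup S \<subseteq> H" "S \<subseteq> generated_subgroup S"
    using assms unfolding generated_subgroup_def by blast+
  show "is_subgroup (generated_subgroup S)"
    unfolding is_subgroup_def
  proof (intro conjI ballI)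
    show "generated_subgroup S \<subseteq> Homeo" using H(1) assms(1) unfolding is_subgroup_def by blast
  qed (simp_all add: generated_subgroup_def is_subgroup_def)
qed

lemma translation_in_TFG:
  assumes "Z2_action \<alpha>"
  shows "\<alpha> \<gamma> \<in> TFG \<alpha>"
proof -
  have "range (\<alpha> \<gamma>) = UNIV" for \<gamma> by (metis Z2_action_minus(2)[OF assms] surjI)
  then have "homeomorphism UNIV UNIV (\<alpha> \<gamma>) (\<alpha> (-\<gamma>))"
    unfolding homeomorphism_def by (simp add: Z2_action_minus[OF assms] Z2_action_continuous[OF assms])
  then have "\<alpha> \<gamma> \<in> Homeo" unfolding Homeo_def by blast
  moreover have "clopen_partition {UNIV}" by (simp add: clopen_partition_def)
  ultimately show ?thesis unfolding TFG_def
    by (intro CollectI conjI exI[of _ "{UNIV}"] exI[of _ "\<lambda>_. \<gamma>"]) auto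
qed

text \<open>The basic neighbourhood of \<open>g\<close> given by \<open>A\<close> and its complement
  consists of homeomorphisms under which \<open>A\<close> has the same image as under
  \<open>g\<close>, and density provides an element of \<open>H\<close> in it.\<close>

lemma dense_subgroup_approx:
  assumes dense: "subtopology homeo_topology (TFG \<alpha>) closure_of H = TFG \<alpha>"
    and g: "g \<in> TFG \<alpha>" and A: "open A" "closed A"
  obtains s where "s \<in> H" "s ` A = g ` A"
proof -
  \<comment> \<open>Members of a clopen partition must be nonempty, so an empty \<open>A\<close> or
    an empty complement is dropped.\<close>
  define \<P> where "\<P> = {A, -A} - {{}}"
  have P: "clopen_partition \<P>" unfolding \<P>_def clopen_partition_def using A by auto
  define N where "N = homeo_basic_nbhd g \<P>"
  have gH: "g \<in> Homeo" using g by (simp add: TFG_def)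
  have bij: "bij g" using g by (rule TFG_homeo)
  have "openin homeo_topology N"
    unfolding homeo_topology_def N_def using P gH by (intro topology_generated_by_Basis) blast
  then have "openin (subtopology homeo_topology (TFG \<alpha>)) (N \<inter> TFG \<alpha>)"
    by (auto simp: openin_subtopology)
  moreover have "(inv g \<circ> g) ` B = B" for B using bij by (simp add: bij_is_inj)
  then have "g \<in> N \<inter> TFG \<alpha>" unfolding N_def homeo_basic_nbhd_def using gH g by blast
  moreover have "g \<in> subtopology homeo_topology (TFG \<alpha>) closure_of H" using g dense by blast
  ultimately have "\<exists>s. s \<in> H \<and> s \<in> N \<inter> TFG \<alpha>" unfolding in_closure_of by blast
  then obtain s where s: "s \<in> H" "s \<in> N" by blast
  have "s ` A = g ` A"
  proof (cases "A = {}")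
    case False
    then have "(inv g \<circ> s) ` A = A" using s(2) unfolding N_def homeo_basic_nbhd_def \<P>_def by blast
    then have "g ` inv g ` s ` A = g ` A" by (simp add: image_comp o_assoc)
    then show ?thesis using bij by (simp add: image_f_inv_f bij_is_surj)
  qed simp
  with s(1) that show thesis by blast
qed

text \<open>Half of the defect of the pair of indicators is a coboundary because of the finite group
  generated by \<open>s\<close> and \<open>t\<close>; subtracting twice that coboundary turns the
  pair into an honest integer cocycle of the same parity.\<close>

lemma no_dense_locally_finite_subgroup:
  assumes act: "Z2_action \<alpha>" "free_action \<alpha>"
    and P: "open P" "closed P" and Q: "open Q" "closed Q"
    and cocycle: "\<And>x. even (of_bool (\<alpha> (0, 1) x \<in> P) - of_bool (x \<in> P)
        - (of_bool (\<alpha> (1, 0) x \<in> Q) - of_bool (x \<in> Q)) :: int)"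
    and no_lift: "\<And>E F :: cantor \<Rightarrow> int. continuous_on UNIV E \<Longrightarrow> continuous_on UNIV F \<Longrightarrow>
        (\<And>x. E (\<alpha> (0, 1) x) - E x = F (\<alpha> (1, 0) x) - F x) \<Longrightarrow>
        (\<And>x. even (E x - of_bool (x \<in> P))) \<Longrightarrow> False"
    and H: "is_subgroup H" "H \<subseteq> TFG \<alpha>" "locally_finite_group H"
    and dense: "subtopology homeo_topology (TFG \<alpha>) closure_of H = TFG \<alpha>"
  shows False
proof -
  \<comment> \<open>The image of \<open>P\<close> under \<open>\<alpha> (- (0, 1))\<close> is the
    preimage of \<open>P\<close> under \<open>\<alpha> (0, 1)\<close>. Translating the indicator by
    the generator thus amounts to applying \<open>t\<close> to \<open>P\<close>; likewise for
    \<open>s\<close> and \<open>Q\<close>.\<close>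
  obtain t where t: "t \<in> H" "t ` P = \<alpha> (- (0, 1)) ` P"
    using dense_subgroup_approx[OF dense translation_in_TFG[OF act(1)] P] .
  obtain s where s: "s \<in> H" "s ` Q = \<alpha> (- (1, 0)) ` Q"
    using dense_subgroup_approx[OF dense translation_in_TFG[OF act(1)] Q] .
  have vimage: "\<alpha> (-\<gamma>) ` A = {x. \<alpha> \<gamma> x \<in> A}" for \<gamma> A
    by (auto simp: Z2_action_minus[OF act(1)] image_iff) (metis Z2_action_minus(1)[OF act(1)])
  define F where "F = generated_subgroup {s, t}"
  have F: "finite F" "is_subgroup F" "F \<subseteq> TFG \<alpha>" "s \<in> F" "t \<in> F"
    unfolding F_def using is_subgroup_generated[OF H(1), of "{s, t}"] s(1) t(1) H(2,3)
    unfolding locally_finite_group_def by auto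
  have cont_iff: "continuous_on UNIV (\<lambda>x. (of_bool (x \<in> A) :: int))" if "open A" "closed A" for A :: "cantor set"
    unfolding continuous_on_fun_bool_iff
  proof
    fix x
    have "x \<in> A \<or> x \<in> - A" by blast
    then obtain B where B: "B = A \<or> B = - A" "x \<in> B" by blast
    with that have "open B" by auto
    with B(2) obtain J where J: "finite J" "{y. \<forall>i\<in>J. y i = x i} \<subseteq> B"
      unfolding open_fun_bool_iff by blast
    have "y \<in> A \<longleftrightarrow> x \<in> A" if "y \<in> B" for y using B that by blast
    with J show "\<exists>J. finite J \<and> (\<forall>y\<in>UNIV. (\<forall>i\<in>J. y i = x i) \<longrightarrow> of_bool (y \<in> A) = (of_bool (x \<in> A) :: int))"
      by (intro exI[of _ J] conjI ballI impI) auto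
  qed
  define p q :: "cantor \<Rightarrow> int" where "p x = of_bool (x \<in> P)" and "q x = of_bool (x \<in> Q)" for x
  have pq: "continuous_on UNIV p" "continuous_on UNIV q"
    unfolding p_def q_def using cont_iff P Q by auto
  define h where "h x = (p (\<alpha> (0, 1) x) - p x - (q (\<alpha> (1, 0) x) - q x)) div 2" for x
  have h2: "2 * h x = p (\<alpha> (0, 1) x) - p x - (q (\<alpha> (1, 0) x) - q x)" for x
    unfolding h_def p_def q_def using cocycle[of x] by simp
  have h: "continuous_on UNIV h"
  proof -
    have "continuous_on UNIV (\<lambda>x. p (\<alpha> (0, 1) x))" "continuous_on UNIV (\<lambda>x. q (\<alpha> (1, 0) x))"
      using continuous_on_compose2[OF _ Z2_action_continuous[OF act(1)]] pq by blast+
    from continuous_on_discrete_combine[OF continuous_on_discrete_combine[OF this(1) pq(1), of "(-)"]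
        continuous_on_discrete_combine[OF this(2) pq(2), of "(-)"], of "\<lambda>a b. (a - b) div 2"]
    show ?thesis unfolding h_def .
  qed
  \<comment> \<open>An element of \<open>F\<close> permutes each orbit of \<open>F\<close>, so a set
    and its image meet the orbit in equally many points.\<close>
  have orbit_sum: "(\<Sum>y\<in>(\<lambda>f. f x) ` F. of_bool (y \<in> f ` A) :: int) = (\<Sum>y\<in>(\<lambda>f. f x) ` F. of_bool (y \<in> A))"
    if f: "f \<in> F" for f x and A :: "cantor set"
  proof -
    have inj: "inj f" using TFG_homeo(2) f F(3) bij_is_inj by blast
    have "f ` (\<lambda>f. f x) ` F \<subseteq> (\<lambda>f. f x) ` F"
    proof clarify
      fix g assume "g \<in> F"
      then have "f \<circ> g \<in> F" using f F(2) unfolding is_subgroup_def by blast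
      then show "f (g x) \<in> (\<lambda>f. f x) ` F" by (metis comp_apply image_eqI)
    qed
    then have "bij_betw f ((\<lambda>f. f x) ` F) ((\<lambda>f. f x) ` F)"
      using inj_on_subset[OF inj subset_UNIV] F(1) by (simp add: bij_betw_def endo_inj_surj)
    from sum.reindex_bij_betw[OF this, of "\<lambda>y. of_bool (y \<in> f ` A) :: int"] show ?thesis
      using inj by (simp add: inj_image_mem_iff)
  qed
  have "coboundary \<alpha> h"
  proof (rule finite_subgroup_coboundary[OF act F(1-3) h])
    fix x
    let ?O = "(\<lambda>f. f x) ` F"
    have "2 * (\<Sum>y\<in>?O. h y) = (\<Sum>y\<in>?O. p (\<alpha> (0, 1) y)) - (\<Sum>y\<in>?O. p y)
      - ((\<Sum>y\<in>?O. q (\<alpha> (1, 0) y)) - (\<Sum>y\<in>?O. q y))"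
      by (simp add: sum_distrib_left h2 sum_subtractf)
    moreover have "p (\<alpha> (0, 1) y) = of_bool (y \<in> t ` P)" for y unfolding p_def t(2) vimage by simp
    moreover have "q (\<alpha> (1, 0) y) = of_bool (y \<in> s ` Q)" for y unfolding q_def s(2) vimage by simp
    ultimately show "(\<Sum>y\<in>?O. h y) = 0"
      using orbit_sum[OF F(4), where A = Q] orbit_sum[OF F(5), where A = P] by (simp add: p_def q_def)
  qed
  then obtain u v where uv: "continuous_on UNIV u" "continuous_on UNIV v"
    "\<And>x. h x = (u (\<alpha> (0, 1) x) - u x) + (v (\<alpha> (1, 0) x) - v x)"
    unfolding coboundary_def by blast
  show False
  proof (rule no_lift)
    \<comment> \<open>Substituting \<open>uv\<close> into \<open>h2\<close> and sorting the
      \<open>u\<close> terms to \<open>p\<close> and the \<open>v\<close> terms to \<open>q\<close>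
      gives an exact cocycle; the corrections are even.\<close>
    show "continuous_on UNIV (\<lambda>x. p x - 2 * u x)"
      by (rule continuous_on_discrete_combine[OF pq(1) uv(1), of "\<lambda>a b. a - 2 * b"])
    show "continuous_on UNIV (\<lambda>x. q x + 2 * v x)"
      by (rule continuous_on_discrete_combine[OF pq(2) uv(2), of "\<lambda>a b. a + 2 * b"])
    show "p (\<alpha> (0, 1) x) - 2 * u (\<alpha> (0, 1) x) - (p x - 2 * u x)
      = q (\<alpha> (1, 0) x) + 2 * v (\<alpha> (1, 0) x) - (q x + 2 * v x)" for x
      using h2[of x] uv(3)[of x] by simp
    show "even (p x - 2 * u x - of_bool (x \<in> P))" for x unfolding p_def by simp
  qed
qed

section \<open>A generalized Morse sequence\<close>

text \<open>\<open>block False\<close> and \<open>block True\<close> list the first and second coordinates of the block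
  \<open>(0, e, e, e + f, e + f, f, f, 0, 0)\<close> over \<open>(\<int>/2)\<^sup>2\<close>, where \<open>e\<close>, \<open>f\<close> is the standard
  basis. Every element occurs in two consecutive places, and the first and last entries vanish.\<close>

definition block :: "bool \<Rightarrow> int \<Rightarrow> bool" where
  "block k r = (if k then 3 \<le> r \<and> r \<le> 6 else 1 \<le> r \<and> r \<le> 4)"

text \<open>Modulo 2 this is the sum of the \<open>block\<close> entries over the base 9 digits of
  \<open>n\<close>, in coordinate \<open>k\<close>. The base cases are the fixed points of division
  by 9: an expansion ends in leading zeros or, for negative \<open>n\<close>, in leading
  eights.\<close>

function morse :: "bool \<Rightarrow> int \<Rightarrow> bool" where
  "morse k n = (if n = 0 \<or> n = -1 then False else morse k (n div 9) \<noteq> block k (n mod 9))"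
  by auto
termination
proof (relation "Wellfounded.measure (\<lambda>(k, n). nat \<bar>n\<bar>)")
  fix k :: bool and n :: int assume "\<not> (n = 0 \<or> n = - 1)"
  then have "\<bar>n div 9\<bar> < \<bar>n\<bar>" by arith
  then show "((k, n div 9), k, n) \<in> Wellfounded.measure (\<lambda>(k, n). nat \<bar>n\<bar>)" by simp
qed simp

declare morse.simps [simp del]

text \<open>The recursion persists at the base cases 0 and -1 because \<open>block\<close> vanishes
  at the digits 0 and 8.\<close>

lemma morse_rec: "morse k n = (morse k (n div 9) \<noteq> block k (n mod 9))"
proof -
  have "(-1::int) div 9 = -1" "(-1::int) mod 9 = 8" by simp_all
  moreover have "morse k 0 = False" "morse k (-1) = False" by (simp_all add: morse.simps)
  ultimately show ?thesis
    by (cases "n = 0 \<or> n = -1") (auto simp: block_def morse.simps[of k n])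
qed

lemma morse_0 [simp]: "\<not> morse k 0"
  by (simp add: morse.simps)

lemma morse_digit: "0 \<le> r \<Longrightarrow> r < 9 \<Longrightarrow> morse k (9 * q + r) = (morse k q \<noteq> block k r)"
  using morse_rec[of k "9 * q + r"] by simp

lemma morse_less_9: "0 \<le> r \<Longrightarrow> r < 9 \<Longrightarrow> morse k r = block k r"
  using morse_digit[of r k 0] by simp

text \<open>The last \<open>m\<close> base 9 digits of the argument are those of \<open>r\<close>
  and the remaining ones those of \<open>n\<close>, so the digit sum splits.\<close>

lemma morse_scale:
  "0 \<le> r \<Longrightarrow> r < 9 ^ m \<Longrightarrow> morse k (9 ^ m * n + r) = (morse k n \<noteq> morse k r)"
proof (induction m arbitrary: r)
  case 0
  then have "r = 0" by simp
  then show ?case by simp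
next
  case (Suc m)
  have eq: "9 ^ Suc m * n + r = 9 * (9 ^ m * n + r div 9) + r mod 9" by simp
  have "r div 9 < x" if "r < 9 * x" for x :: int using that by presburger
  then have "r div 9 < 9 ^ m" using Suc.prems(2) by simp
  then have "morse k (9 ^ m * n + r div 9) = (morse k n \<noteq> morse k (r div 9))"
    using Suc.IH[of "r div 9"] Suc.prems by (simp add: pos_imp_zdiv_nonneg_iff)
  then show ?case unfolding eq using morse_digit[of "r mod 9" k "9 ^ m * n + r div 9"] morse_rec[of k r] by auto
qed

text \<open>The left half of the window lies in the block governed by \<open>n - 1\<close>. As the
  values at \<open>n - 1\<close> and \<open>n\<close> agree, the two-sided window is a translate of
  the one around 0, where the values at -1 and 0 both vanish.\<close>

lemma morse_block:
  assumes "morse k (n - 1) = morse k n" "- (9 ^ m) \<le> r" "r < 9 ^ m"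
  shows "morse k (9 ^ m * n + r) = (morse k n \<noteq> morse k r)"
proof (cases "0 \<le> r")
  case True
  with assms show ?thesis by (simp add: morse_scale)
next
  case False
  have scale: "morse k (9 ^ m * l + (9 ^ m + r)) = (morse k l \<noteq> morse k (9 ^ m + r))" for l
    using morse_scale[of "9 ^ m + r" m k l] False assms by simp
  have eq: "9 ^ m * n + r = 9 ^ m * (n - 1) + (9 ^ m + r)" by (simp add: algebra_simps)
  have 1: "morse k (9 ^ m * n + r) = (morse k (n - 1) \<noteq> morse k (9 ^ m + r))"
    unfolding eq by (rule scale)
  have 2: "morse k r = (morse k (- 1) \<noteq> morse k (9 ^ m + r))"
    using scale[of "-1"] by simp
  have "\<not> morse k (-1)" by (simp add: morse.simps)
  with 1 2 assms(1) show ?thesis by simp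
qed

text \<open>The places 2, 4, 6 and 8 are the right members of the four pairs of equal neighbours in
  the block. They are the places to which \<open>morse_block\<close> is applied.\<close>

lemma ex_block_eq:
  obtains r where "2 \<le> r" "r \<le> 8" "\<And>k. block k r = g k" "\<And>k. block k (r - 1) = g k"
proof -
  define r :: int where "r = (if g True then if g False then 4 else 6 else if g False then 2 else 8)"
  have "block k r = g k" "block k (r - 1) = g k" for k
    by (cases k; simp add: block_def r_def)+
  moreover have "2 \<le> r" "r \<le> 8" by (simp_all add: r_def)
  ultimately show thesis using that by blast
qed

text \<open>Copies of the central window have bounded gaps, in both coordinates at once: inside the
  next block of length \<open>9 ^ Suc m\<close> some digit cancels the value of that block. Reaching
  the block costs at most \<open>9 * 9 ^ m\<close>, and the place inside it at most
  \<open>8 * 9 ^ m\<close>.\<close>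

lemma morse_recurrent:
  obtains a where "0 \<le> a" "a < 18 * 9 ^ m" "\<forall>k j. - (9 ^ m) \<le> j \<and> j < 9 ^ m \<longrightarrow> morse k (s + a + j) = morse k j"
proof -
  \<comment> \<open>This is the first block of length \<open>9 ^ Suc m\<close> that begins to the
    right of \<open>s\<close>.\<close>
  define q where "q = s div 9 ^ Suc m + 1"
  obtain r where r: "2 \<le> r" "r \<le> 8" "\<And>k. block k r = morse k q" "\<And>k. block k (r - 1) = morse k q"
    using ex_block_eq[of "\<lambda>k. morse k q"] by blast
  define n where "n = 9 * q + r"
  have n: "\<not> morse k n" for k unfolding n_def using morse_digit[of r k q] r by simp
  have n1: "\<not> morse k (n - 1)" for k
    using morse_digit[of "r - 1" k q] r by (simp add: n_def algebra_simps)
  define a where "a = 9 ^ m * n - s"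
  have s: "s = 9 ^ Suc m * (s div 9 ^ Suc m) + s mod 9 ^ Suc m" by simp
  have bounds: "0 \<le> s mod 9 ^ Suc m" "s mod 9 ^ Suc m < 9 * 9 ^ m" by simp_all
  have a: "a = 9 * 9 ^ m + 9 ^ m * r - s mod 9 ^ Suc m"
    unfolding a_def n_def q_def by (subst (1) s) (simp add: algebra_simps)
  have "9 ^ m * r \<le> 9 ^ m * 8" "0 \<le> 9 ^ m * r" using r by simp_all
  with a bounds have "0 \<le> a" "a < 18 * 9 ^ m" by linarith+
  moreover have "\<forall>k j. - (9 ^ m) \<le> j \<and> j < 9 ^ m \<longrightarrow> morse k (s + a + j) = morse k j"
    using morse_block[of _ n m] n n1 by (simp add: a_def)
  ultimately show thesis by (rule that)
qed

text \<open>If \<open>9 ^ m\<close> exceeds the period, all residues lie in a window that recurs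
  unchanged at \<open>2 * 9 ^ m\<close>, the second coordinate of the block being zero at place 2.
  Hence \<open>2 * 9 ^ m\<close> is a period as well, but the values at \<open>2 * 9 ^ m\<close> and
  \<open>4 * 9 ^ m\<close> differ.\<close>

lemma morse_not_periodic:
  assumes per: "\<And>i. morse True (i + p) = morse True i"
  shows "p = 0"
proof (rule ccontr)
  assume p: "p \<noteq> 0"
  have per_nat: "morse True (i + int n * p) = morse True i" for i n
  proof (induction n)
    case (Suc n)
    then show ?case using per[of "i + int n * p"] by (simp add: algebra_simps)
  qed simp
  have per_int: "morse True (i + q * p) = morse True i" for i q
  proof (cases "0 \<le> q")
    case True
    then show ?thesis using per_nat[of i "nat q"] by simp
  next
    case False
    then show ?thesis using per_nat[of "i + q * p" "nat (- q)"] by (simp add: algebra_simps)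
  qed
  have per_abs: "morse True (i + q * \<bar>p\<bar>) = morse True i" for i q
    using per_int[of i q] per_int[of i "- q"] by (cases "0 \<le> p") simp_all
  define m where "m = nat \<bar>p\<bar>"
  have m: "\<bar>p\<bar> < 9 ^ m"
  proof -
    have "m < 9 ^ m" by (rule power_gt_expt) simp
    then have "int m < 9 ^ m" by (metis of_nat_less_iff of_nat_numeral of_nat_power)
    then show ?thesis by (simp add: m_def)
  qed
  have 2: "morse k 2 = block k 2" "morse k 1 = block k 1" "morse k 4 = block k 4" "morse k 3 = block k 3" for k
    using morse_less_9 by simp_all
  have shift: "morse True (9 ^ m * 2 + j) = morse True j" for j
  proof -
    define r where "r = j mod \<bar>p\<bar>"
    have r: "0 \<le> r" "r < 9 ^ m"
      using p m pos_mod_bound[of "\<bar>p\<bar>" j] pos_mod_sign[of "\<bar>p\<bar>" j] unfolding r_def by linarith+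
    have j: "j = r + (j div \<bar>p\<bar>) * \<bar>p\<bar>" unfolding r_def by (simp only: mod_div_mult_eq)
    then have j2: "9 ^ m * 2 + j = (9 ^ m * 2 + r) + (j div \<bar>p\<bar>) * \<bar>p\<bar>" by linarith
    have "morse True (9 ^ m * 2 + j) = morse True (9 ^ m * 2 + r)" "morse True j = morse True r"
      by (subst j2, rule per_abs) (subst j, rule per_abs)
    moreover have "morse True (9 ^ m * 2 + r) = (morse True 2 \<noteq> morse True r)"
      using r by (simp add: morse_scale)
    ultimately show ?thesis using 2 by (simp add: block_def)
  qed
  have eq: "9 ^ m * 4 = 9 ^ m * 2 + (9 ^ m * 2 :: int)" by simp
  have "morse True (9 ^ m * 4) = morse True (9 ^ m * 2)" unfolding eq by (rule shift)
  moreover have "morse True (9 ^ m * 4) = morse True 4" "morse True (9 ^ m * 2) = morse True 2"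
    using morse_scale[of 0 m True 4] morse_scale[of 0 m True 2] by simp_all
  ultimately show False using 2 by (simp add: block_def)
qed

section \<open>Nonexistence of an integral lift\<close>

text \<open>A discrete Green formula: the cocycle identity summed over the unit squares of a
  rectangle leaves only the boundary terms.\<close>

lemma green_rectangle:
  fixes e f :: "int \<Rightarrow> int \<Rightarrow> int"
  assumes "\<And>s t. e s (t + 1) - e s t = f (s + 1) t - f s t"
  shows "(\<Sum>i<n. e (s + int i) (t + int l)) - (\<Sum>i<n. e (s + int i) t)
    = (\<Sum>j<l. f (s + int n) (t + int j)) - (\<Sum>j<l. f s (t + int j))"
proof (induction l)
  case (Suc l)
  have "e (s + int i) (t + int l + 1) - e (s + int i) (t + int l)
    = f (s + int (Suc i)) (t + int l) - f (s + int i) (t + int l)" for i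
    using assms[of "s + int i" "t + int l"] by (simp add: add_ac)
  then have "(\<Sum>i<n. e (s + int i) (t + int l + 1)) - (\<Sum>i<n. e (s + int i) (t + int l))
    = (\<Sum>i<n. f (s + int (Suc i)) (t + int l) - f (s + int i) (t + int l))"
    by (simp only: sum_subtractf[symmetric])
  also have "\<dots> = f (s + int n) (t + int l) - f s (t + int l)"
    by (subst sum_lessThan_telescope) simp
  finally show ?case using Suc by (simp add: add_ac)
qed simp

text \<open>Modulo 2 the summand is the difference of consecutive bits, so only the two ends
  remain.\<close>

lemma even_telescope:
  fixes d :: "nat \<Rightarrow> int" and x :: "nat \<Rightarrow> bool"
  assumes "\<And>i. even (d i - of_bool (x (Suc i) \<noteq> x i))"
  shows "even ((\<Sum>i<n. d i) - of_bool (x n \<noteq> x 0))"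
proof (induction n)
  case (Suc n)
  then show ?case using assms[of n] by (cases "x n"; cases "x (Suc n)"; cases "x 0") auto
qed simp

text \<open>Let A and B flip the first and second argument. The second and third equations
  multiplied by B - 1, together with the fourth, give (B - 1)^2 A (P1 - Q1) = 0. As B is an
  involution, (B - 1)^2 = -2 (B - 1). Dividing by 2, which is possible over the integers but not
  modulo 2, and inserting the result into the third equation yields (A - 1) P2 = (B - 1) A P1; the
  claim is one value of this.\<close>

lemma rectangle_parity:
  fixes P1 P2 Q1 Q2 :: "bool \<Rightarrow> bool \<Rightarrow> int"
  assumes "\<And>a b. P1 (\<not> a) b - P1 a b = Q1 (\<not> a) b - Q1 a b"
    "\<And>a b. P1 (\<not> a) (\<not> b) - P1 (\<not> a) b = Q2 (\<not> a) b - Q2 a b"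
    "\<And>a b. P2 (\<not> a) b - P2 a b = Q1 (\<not> a) (\<not> b) - Q1 (\<not> a) b"
    "\<And>a b. P2 (\<not> a) (\<not> b) - P2 (\<not> a) b = Q2 (\<not> a) (\<not> b) - Q2 (\<not> a) b"
  shows "P2 False False - P2 True False = P1 False True - P1 False False"
  using assms[of True True] assms[of True False] assms[of False True] assms[of False False] by simp

definition offset :: "bool \<Rightarrow> bool \<Rightarrow> bool \<Rightarrow> bool" where
  "offset a b k = (if k then b else a)"

text \<open>Here \<open>e s t g\<close> and \<open>f s t g\<close> stand for the components of a
  cocycle at the array with offsets \<open>s\<close>, \<open>t\<close> and added constant
  \<open>g\<close>. Since \<open>t\<close> and \<open>g\<close> enter only through the sequence
  around \<open>t\<close> plus \<open>g\<close>, continuity takes the form \<open>local_e\<close>;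
  \<open>local_f\<close> is the same for \<open>s\<close>.\<close>

lemma no_integral_lift:
  fixes e f :: "int \<Rightarrow> int \<Rightarrow> (bool \<Rightarrow> bool) \<Rightarrow> int"
  assumes cocycle: "\<And>s t g. e s (t + 1) g - e s t g = f (s + 1) t g - f s t g"
    and local_e: "\<And>s t t' g g'. (\<And>k j. - (9 ^ m) \<le> j \<Longrightarrow> j < 9 ^ m \<Longrightarrow>
      (morse k (t + j) \<noteq> g k) = (morse k (t' + j) \<noteq> g' k)) \<Longrightarrow> e s t g = e s t' g'"
    and local_f: "\<And>s s' t g g'. (\<And>k j. - (9 ^ m) \<le> j \<Longrightarrow> j < 9 ^ m \<Longrightarrow>
      (morse k (s + j) \<noteq> g k) = (morse k (s' + j) \<noteq> g' k)) \<Longrightarrow> f s t g = f s' t g'"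
    and parity: "\<And>s t g. even (e s t g - of_bool ((morse False s \<noteq> (morse False t \<noteq> g False)) \<and>
      morse True (s + 1) \<noteq> morse True s))"
  shows False
proof -
  \<comment> \<open>\<open>M\<close> and \<open>2 * M\<close> are \<open>9 ^ m\<close> times the
    places 2 and 4 of the block. The window around \<open>M\<close> is the central one with the
    first coordinate flipped, and around \<open>2 * M\<close> both coordinates are flipped.\<close>
  define M :: int where "M = 2 * 9 ^ m"
  define N where "N = nat M"
  have N: "int N = M" by (simp add: N_def M_def)
  have 2: "morse k 2 = block k 2" "morse k 1 = block k 1" "morse k 4 = block k 4" "morse k 3 = block k 3" for k
    using morse_less_9 by simp_all
  have m1: "morse k (M + j) = (\<not> k \<noteq> morse k j)" if "- (9 ^ m) \<le> j" "j < 9 ^ m" for k j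
    using morse_block[of k 2 m j] that 2[of k] by (cases k) (auto simp: M_def block_def mult.commute)
  have m2: "morse k (2 * M + j) = (\<not> morse k j)" if "- (9 ^ m) \<le> j" "j < 9 ^ m" for k j
    using morse_block[of k 4 m j] that 2[of k] by (cases k) (auto simp: M_def block_def mult.commute)
  have e1: "e s M (offset a b) = e s 0 (offset (\<not> a) b)" for s a b
    by (rule local_e) (auto simp: m1 offset_def)
  have e2: "e s (2 * M) (offset a b) = e s 0 (offset (\<not> a) (\<not> b))" for s a b
    by (rule local_e) (auto simp: m2 offset_def)
  have f1: "f M t (offset a b) = f 0 t (offset (\<not> a) b)" for t a b
    by (rule local_f) (auto simp: m1 offset_def)
  have f2: "f (2 * M) t (offset a b) = f 0 t (offset (\<not> a) (\<not> b))" for t a b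
    by (rule local_f) (auto simp: m2 offset_def)
  \<comment> \<open>These are sums along the sides of the four squares with corners in {0, M, 2M}.
    By \<open>e1\<close> to \<open>f2\<close> every side can be moved to one of the two axes at the
    cost of changing the constant.\<close>
  define P1 where "P1 a b = (\<Sum>i<N. e (int i) 0 (offset a b))" for a b
  define P2 where "P2 a b = (\<Sum>i<N. e (M + int i) 0 (offset a b))" for a b
  define Q1 where "Q1 a b = (\<Sum>j<N. f 0 (int j) (offset a b))" for a b
  define Q2 where "Q2 a b = (\<Sum>j<N. f 0 (M + int j) (offset a b))" for a b
  have green: "(\<Sum>i<N. e (s + int i) (t + M) g) - (\<Sum>i<N. e (s + int i) t g)
    = (\<Sum>j<N. f (s + M) (t + int j) g) - (\<Sum>j<N. f s (t + int j) g)" for s t g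
    using green_rectangle[where e = "\<lambda>s t. e s t g" and f = "\<lambda>s t. f s t g" and n = N and l = N
        and s = s and t = t] cocycle N by simp
  have key: "P2 False False - P2 True False = P1 False True - P1 False False"
  proof (rule rectangle_parity)
    fix a b
    show "P1 (\<not> a) b - P1 a b = Q1 (\<not> a) b - Q1 a b"
      using green[of 0 0 "offset a b"] by (simp add: e1 f1 P1_def Q1_def)
    show "P1 (\<not> a) (\<not> b) - P1 (\<not> a) b = Q2 (\<not> a) b - Q2 a b"
      using green[of 0 M "offset a b"] by (simp add: e1 e2 f1 P1_def Q2_def)
    show "P2 (\<not> a) b - P2 a b = Q1 (\<not> a) (\<not> b) - Q1 (\<not> a) b"
      using green[of M 0 "offset a b"] by (simp add: e1 f1 f2 P2_def Q1_def)
    show "P2 (\<not> a) (\<not> b) - P2 (\<not> a) b = Q2 (\<not> a) (\<not> b) - Q2 (\<not> a) b"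
      using green[of M M "offset a b"] by (simp add: e1 e2 f1 f2 P2_def Q2_def)
  qed
  \<comment> \<open>The parity of \<open>e\<close> does not involve the second coordinate of the
    constant.\<close>
  have "even (P1 False True - P1 False False)"
  proof -
    have "even (e s 0 (offset False True) - e s 0 (offset False False))" for s
      using parity[of s 0 "offset False True"] parity[of s 0 "offset False False"] by (simp add: offset_def)
    then show ?thesis unfolding P1_def sum_subtractf[symmetric] by (simp add: dvd_sum)
  qed
  \<comment> \<open>Flipping the first coordinate of the constant changes the parity of
    \<open>e\<close> exactly where the second coordinate of the sequence jumps. The number of jumps
    between \<open>M\<close> and \<open>2 * M\<close> is odd because the values at these two ends
    differ.\<close>
  moreover have "odd (P2 False False - P2 True False)"
  proof -
    define x where "x i = morse True (M + int i)" for i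
    have x_Suc: "x (Suc i) = morse True (M + int i + 1)" for i by (simp add: x_def add_ac)
    have par: "even (e s 0 (offset False False) - e s 0 (offset True False)
      - of_bool (morse True (s + 1) \<noteq> morse True s))" for s
      using parity[of s 0 "offset False False"] parity[of s 0 "offset True False"]
      by (cases "morse False s"; cases "morse True (s + 1) \<noteq> morse True s") (auto simp: offset_def)
    have "even ((\<Sum>i<N. e (M + int i) 0 (offset False False) - e (M + int i) 0 (offset True False))
      - of_bool (x N \<noteq> x 0))"
      by (rule even_telescope, unfold x_Suc) (unfold x_def, rule par)
    moreover have "x N" "\<not> x 0" using m1[of 0 True] m2[of 0 True] N by (simp_all add: x_def)
    ultimately show ?thesis by (simp add: P2_def sum_subtractf)
  qed
  ultimately show False using key by simp
qed

section \<open>The array system\<close>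

text \<open>Planar arrays with entries in (Z/2)^2; the boolean index selects the coordinate of the
  entry.\<close>

type_synonym arr = "int \<times> int \<times> bool \<Rightarrow> bool"

definition shift :: "int \<times> int \<Rightarrow> arr \<Rightarrow> arr" where
  "shift \<gamma> z = (\<lambda>(i, j, k). z (i + fst \<gamma>, j + snd \<gamma>, k))"

definition sum_array :: "int \<Rightarrow> int \<Rightarrow> (bool \<Rightarrow> bool) \<Rightarrow> arr" where
  "sum_array s t g = (\<lambda>(i, j, k). morse k (i + s) \<noteq> (morse k (j + t) \<noteq> g k))"

text \<open>The range is the shift orbit of \<open>sum_array 0 0 (\<lambda>_. False)\<close>, so
  this is an orbit closure.\<close>

definition array_space :: "arr set" where
  "array_space = closure (range (\<lambda>(s, t). sum_array s t (\<lambda>_. False)))"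

text \<open>Powers of 9 as half-widths fit the windows of \<open>morse_block\<close>.\<close>

definition agree_on_box :: "nat \<Rightarrow> arr \<Rightarrow> arr \<Rightarrow> bool" where
  "agree_on_box m z w \<longleftrightarrow> (\<forall>i j k. \<bar>i\<bar> < 9 ^ m \<longrightarrow> \<bar>j\<bar> < 9 ^ m \<longrightarrow> z (i, j, k) = w (i, j, k))"

lemma ex_power9_gt: obtains m where "x < (9 ^ m :: int)"
proof
  have "nat x < 9 ^ nat x" by (rule power_gt_expt) simp
  then have "int (nat x) < 9 ^ nat x" by (metis of_nat_less_iff of_nat_numeral of_nat_power)
  then show "x < 9 ^ nat x" by linarith
qed

lemma agree_finite:
  assumes "finite J"
  obtains m where "\<forall>z w. agree_on_box m z w \<longrightarrow> (\<forall>i\<in>J. z i = w i)"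
proof -
  define B where "B = (\<lambda>(i :: int, j :: int, k :: bool). \<bar>i\<bar> + \<bar>j\<bar>)"
  obtain b where b: "\<And>x. x \<in> J \<Longrightarrow> B x \<le> b"
    using assms finite_imageI[of J B] by (metis Max_ge image_eqI)
  obtain m where m: "b < 9 ^ m" by (rule ex_power9_gt)
  have "\<forall>i\<in>J. z i = w i" if "agree_on_box m z w" for z w
  proof
    fix x assume "x \<in> J"
    moreover obtain i j k where x: "x = (i, j, k)" by (cases x)
    ultimately have "\<bar>i\<bar> + \<bar>j\<bar> < 9 ^ m" using b[of x] m by (simp add: B_def)
    with that show "z x = w x" unfolding x agree_on_box_def by simp
  qed
  then show thesis using that by blast
qed

lemma closure_arr_iff: "z \<in> closure A \<longleftrightarrow> (\<forall>m. \<exists>w\<in>A. agree_on_box m w z)" for z :: arr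
proof
  assume z: "z \<in> closure A"
  show "\<forall>m. \<exists>w\<in>A. agree_on_box m w z"
  proof
    fix m :: nat
    let ?J = "{- (9 ^ m) .. (9 ^ m :: int)} \<times> {- (9 ^ m) .. (9 ^ m :: int)} \<times> (UNIV :: bool set)"
    have "finite ?J" by simp
    with z obtain w where w: "w \<in> A" "\<forall>i\<in>?J. w i = z i" unfolding closure_fun_bool_iff by blast
    have "agree_on_box m w z" unfolding agree_on_box_def
    proof (intro allI impI)
      fix i j k assume "\<bar>i\<bar> < (9 ^ m :: int)" "\<bar>j\<bar> < (9 ^ m :: int)"
      then have "(i, j, k) \<in> ?J" by auto
      with w(2) show "w (i, j, k) = z (i, j, k)" by blast
    qed
    with w(1) show "\<exists>w\<in>A. agree_on_box m w z" by blast
  qed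
next
  assume r: "\<forall>m. \<exists>w\<in>A. agree_on_box m w z"
  show "z \<in> closure A" unfolding closure_fun_bool_iff
  proof (intro allI impI)
    fix J :: "(int \<times> int \<times> bool) set" assume "finite J"
    then obtain m where m: "\<forall>z w. agree_on_box m z w \<longrightarrow> (\<forall>i\<in>J. z i = w i)" by (rule agree_finite)
    from r obtain w where w: "w \<in> A" "agree_on_box m w z" by blast
    show "\<exists>y\<in>A. \<forall>i\<in>J. y i = z i"
    proof
      show "\<forall>i\<in>J. w i = z i" by (rule m[THEN spec, THEN spec, THEN mp, OF w(2)])
    qed (rule w(1))
  qed
qed

lemma array_space_iff: "z \<in> array_space \<longleftrightarrow> (\<forall>m. \<exists>s t. agree_on_box m (sum_array s t (\<lambda>_. False)) z)"
  unfolding array_space_def closure_arr_iff by (auto simp: image_iff)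

lemma closed_array_space: "closed array_space"
  unfolding array_space_def by simp

lemma shift_zero: "shift (0, 0) = id"
  by (simp add: shift_def fun_eq_iff)

lemma shift_add: "shift (a + c, b + d) = shift (a, b) \<circ> shift (c, d)"
  by (simp add: shift_def fun_eq_iff add_ac)

lemma shift_apply: "shift (a, b) z (i, j, k) = z (i + a, j + b, k)"
  by (simp add: shift_def)

lemma shift_sum_array: "shift (a, b) (sum_array s t g) = sum_array (s + a) (t + b) g"
  by (simp add: shift_def sum_array_def fun_eq_iff add_ac)

lemma sum_array_apply: "sum_array s t g (i, j, k) = (morse k (i + s) \<noteq> (morse k (j + t) \<noteq> g k))"
  by (simp add: sum_array_def)

lemma agree_shift:
  assumes "agree_on_box n z w" "9 ^ m + \<bar>a\<bar> + \<bar>b\<bar> \<le> (9 ^ n :: int)"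
  shows "agree_on_box m (shift (a, b) z) (shift (a, b) w)"
  unfolding agree_on_box_def
proof (intro allI impI)
  fix i j :: int and k assume "\<bar>i\<bar> < 9 ^ m" "\<bar>j\<bar> < 9 ^ m"
  with assms(2) have "\<bar>i + a\<bar> < 9 ^ n" "\<bar>j + b\<bar> < 9 ^ n" by linarith+
  with assms(1) show "shift (a, b) z (i, j, k) = shift (a, b) w (i, j, k)"
    unfolding agree_on_box_def shift_apply by blast
qed

lemma agree_trans: "agree_on_box m z w \<Longrightarrow> agree_on_box m w v \<Longrightarrow> agree_on_box m z v"
  unfolding agree_on_box_def by simp

lemma agree_sym: "agree_on_box m z w \<Longrightarrow> agree_on_box m w z"
  unfolding agree_on_box_def by simp

lemma shift_array_space:
  assumes "z \<in> array_space"
  shows "shift \<gamma> z \<in> array_space"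
  unfolding array_space_iff
proof
  fix m
  obtain a b where g: "\<gamma> = (a, b)" by (cases \<gamma>)
  obtain n where n: "9 ^ m + \<bar>a\<bar> + \<bar>b\<bar> < (9 ^ n :: int)" by (rule ex_power9_gt)
  from assms obtain s t where "agree_on_box n (sum_array s t (\<lambda>_. False)) z" unfolding array_space_iff by blast
  from agree_shift[OF this, of m a b] n
  have "agree_on_box m (sum_array (s + a) (t + b) (\<lambda>_. False)) (shift \<gamma> z)" unfolding g shift_sum_array by simp
  then show "\<exists>s t. agree_on_box m (sum_array s t (\<lambda>_. False)) (shift \<gamma> z)" by blast
qed

text \<open>The constant \<open>g\<close> is absorbed by a translation: around
  \<open>9 ^ n * r\<close>, where the block has the entry \<open>g\<close> at \<open>r - 1\<close>
  and \<open>r\<close>, the sequence is the central window plus \<open>g\<close>.\<close>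

lemma sum_array_in_array_space: "sum_array s t g \<in> array_space"
  unfolding array_space_iff
proof
  fix m
  obtain n where n: "9 ^ m + \<bar>s\<bar> < (9 ^ n :: int)" by (rule ex_power9_gt)
  obtain r where r: "2 \<le> r" "r \<le> 8" "\<And>k. block k r = g k" "\<And>k. block k (r - 1) = g k"
    using ex_block_eq[of g] by blast
  have mr: "morse k r = g k" "morse k (r - 1) = g k" for k using morse_less_9 r by simp_all
  have "agree_on_box m (sum_array (s + 9 ^ n * r) t (\<lambda>_. False)) (sum_array s t g)"
    unfolding agree_on_box_def
  proof (intro allI impI)
    fix i j :: int and k assume "\<bar>i\<bar> < 9 ^ m" "\<bar>j\<bar> < 9 ^ m"
    then have "- (9 ^ n) \<le> i + s" "i + s < 9 ^ n" using n by linarith+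
    then have "morse k (9 ^ n * r + (i + s)) = (g k \<noteq> morse k (i + s))"
      using morse_block[of k r n "i + s"] mr by simp
    then show "sum_array (s + 9 ^ n * r) t (\<lambda>_. False) (i, j, k) = sum_array s t g (i, j, k)"
      unfolding sum_array_apply by (auto simp: add_ac)
  qed
  then show "\<exists>s' t'. agree_on_box m (sum_array s' t' (\<lambda>_. False)) (sum_array s t g)" by blast
qed

section \<open>Minimality, freeness and perfectness of the array system\<close>

text \<open>By bounded gaps a large box of \<open>z\<close> contains a copy of a central box of
  \<open>sum_array 0 0 (\<lambda>_. False)\<close>, and that central box contains the prescribed
  pattern of \<open>w\<close> around \<open>(s, t)\<close>.\<close>

lemma array_space_minimal:
  assumes z: "z \<in> array_space" and w: "w \<in> array_space"
  shows "\<exists>\<gamma>. agree_on_box m (shift \<gamma> z) w"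
proof -
  from w obtain s t where st: "agree_on_box m (sum_array s t (\<lambda>_. False)) w" unfolding array_space_iff by blast
  obtain n where n: "9 ^ m + \<bar>s\<bar> + \<bar>t\<bar> < (9 ^ n :: int)" by (rule ex_power9_gt)
  \<comment> \<open>Enlarging \<open>n\<close> by 2 multiplies the half-width by 81, which leaves
    room for two displacements below \<open>18 * 9 ^ n\<close> each.\<close>
  from z obtain s' t' where st': "agree_on_box (n + 2) (sum_array s' t' (\<lambda>_. False)) z" unfolding array_space_iff by blast
  obtain a where a: "0 \<le> a" "a < 18 * 9 ^ n" "\<forall>k j. - (9 ^ n) \<le> j \<and> j < 9 ^ n \<longrightarrow> morse k (s' + a + j) = morse k j"
    by (rule morse_recurrent[of n s'])
  obtain b where b: "0 \<le> b" "b < 18 * 9 ^ n" "\<forall>k j. - (9 ^ n) \<le> j \<and> j < 9 ^ n \<longrightarrow> morse k (t' + b + j) = morse k j"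
    by (rule morse_recurrent[of n t'])
  have pow: "(9 :: int) ^ (n + 2) = 81 * 9 ^ n" by simp
  have "agree_on_box n (shift (a, b) (sum_array s' t' (\<lambda>_. False))) (shift (a, b) z)"
    by (rule agree_shift[OF st']) (use a(1,2) b(1,2) pow in linarith)
  moreover have "agree_on_box n (sum_array 0 0 (\<lambda>_. False)) (shift (a, b) (sum_array s' t' (\<lambda>_. False)))"
    unfolding agree_on_box_def shift_sum_array sum_array_apply
  proof (intro allI impI)
    fix i j :: int and k assume ij: "\<bar>i\<bar> < 9 ^ n" "\<bar>j\<bar> < 9 ^ n"
    then have "- (9 ^ n) \<le> i \<and> i < 9 ^ n" "- (9 ^ n) \<le> j \<and> j < 9 ^ n" by linarith+
    then have "morse k (s' + a + i) = morse k i" "morse k (t' + b + j) = morse k j"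
      using a(3) b(3) by blast+
    then show "(morse k (i + 0) \<noteq> (morse k (j + 0) \<noteq> False)) = (morse k (i + (s' + a)) \<noteq> (morse k (j + (t' + b)) \<noteq> False))"
      by (simp add: add_ac)
  qed
  ultimately have "agree_on_box n (sum_array 0 0 (\<lambda>_. False)) (shift (a, b) z)" by (rule agree_trans[rotated])
  from agree_shift[OF this, of m s t] n
  have "agree_on_box m (sum_array s t (\<lambda>_. False)) (shift (s, t) (shift (a, b) z))"
    by (simp add: shift_sum_array)
  then have "agree_on_box m (shift (s, t) (shift (a, b) z)) w"
    using st agree_sym agree_trans by blast
  then have "agree_on_box m (shift (s + a, t + b) z) w" by (simp add: shift_add)
  then show ?thesis by blast
qed

text \<open>By minimality the period of \<open>z\<close> is inherited by
  \<open>sum_array 0 0 (\<lambda>_. False)\<close>. Then the increments of the sequence by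
  \<open>a\<close> and by \<open>b\<close> equal one constant of order at most two, so
  \<open>2 * a\<close> and \<open>2 * b\<close> are periods of the sequence.\<close>

lemma array_space_free:
  assumes z: "z \<in> array_space" and fixed: "shift (a, b) z = z"
  shows "a = 0 \<and> b = 0"
proof -
  let ?c = "sum_array 0 0 (\<lambda>_. False)"
  have c: "?c (i + a, j + b, k) = ?c (i, j, k)" for i j k
  proof -
    obtain m where m: "\<bar>i\<bar> + \<bar>j\<bar> + \<bar>a\<bar> + \<bar>b\<bar> < (9 ^ m :: int)" by (rule ex_power9_gt)
    obtain c d where "agree_on_box m (shift (c, d) z) ?c"
      using array_space_minimal[OF z sum_array_in_array_space] by (metis surj_pair)
    then have eq: "z (x + c, y + d, k) = ?c (x, y, k)" if "\<bar>x\<bar> < 9 ^ m" "\<bar>y\<bar> < 9 ^ m" for x y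
      using that unfolding agree_on_box_def shift_apply by blast
    have "z (i + a + c, j + b + d, k) = ?c (i + a, j + b, k)" by (rule eq) (use m in linarith)+
    moreover have "z (i + c, j + d, k) = ?c (i, j, k)" by (rule eq) (use m in linarith)+
    moreover have "z (i + c + a, j + d + b, k) = z (i + c, j + d, k)" by (metis fixed shift_apply)
    ultimately show ?thesis by (simp add: add_ac)
  qed
  have eq: "(morse k (i + a) \<noteq> morse k i) = (morse k (j + b) \<noteq> morse k j)" for i j k
    using c[of i j k] unfolding sum_array_apply by auto
  have "morse True (i + 2 * a) = morse True i" for i
    using eq[where k = True and i = i and j = 0] eq[where k = True and i = "i + a" and j = 0] by (auto simp: algebra_simps)
  then have "2 * a = 0" by (rule morse_not_periodic)
  moreover have "morse True (j + 2 * b) = morse True j" for j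
    using eq[where k = True and j = j and i = 0] eq[where k = True and j = "j + b" and i = 0] by (auto simp: algebra_simps)
  then have "2 * b = 0" by (rule morse_not_periodic)
  ultimately show ?thesis by simp
qed

text \<open>As the block vanishes at 7 and 8, translation by \<open>9 ^ n * 8\<close> reproduces the
  window, and by freeness it changes the array. Of two different arrays that agree with
  \<open>z\<close> on the box, at least one is not \<open>z\<close>.\<close>

lemma array_space_perfect:
  assumes z: "z \<in> array_space" and J: "finite J"
  shows "\<exists>w\<in>array_space. w \<noteq> z \<and> (\<forall>i\<in>J. w i = z i)"
proof -
  obtain m where m: "\<forall>z w. agree_on_box m z w \<longrightarrow> (\<forall>i\<in>J. z i = w i)" by (rule agree_finite[OF J])
  from z obtain s t where st: "agree_on_box m (sum_array s t (\<lambda>_. False)) z" unfolding array_space_iff by blast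
  obtain n where n: "9 ^ m + \<bar>s\<bar> < (9 ^ n :: int)" by (rule ex_power9_gt)
  let ?w = "sum_array s t (\<lambda>_. False)" and ?w' = "sum_array (s + 9 ^ n * 8) t (\<lambda>_. False)"
  have m8: "\<not> morse k 8" "\<not> morse k 7" for k using morse_less_9 by (simp_all add: block_def)
  have "agree_on_box m ?w' ?w" unfolding agree_on_box_def
  proof (intro allI impI)
    fix i j :: int and k assume "\<bar>i\<bar> < 9 ^ m" "\<bar>j\<bar> < 9 ^ m"
    then have "- (9 ^ n) \<le> i + s" "i + s < 9 ^ n" using n by linarith+
    then have "morse k (9 ^ n * 8 + (i + s)) = morse k (i + s)"
      using morse_block[of k 8 n "i + s"] m8 by simp
    then show "?w' (i, j, k) = ?w (i, j, k)" unfolding sum_array_apply by (simp add: add_ac)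
  qed
  then have w': "agree_on_box m ?w' z" using st by (rule agree_trans)
  have "shift (9 ^ n * 8, 0) ?w = ?w'" by (simp add: shift_sum_array)
  then have "?w' \<noteq> ?w" using array_space_free[OF sum_array_in_array_space, of "9 ^ n * 8" 0 s t] by auto
  then consider "?w \<noteq> z" | "?w' \<noteq> z" by blast
  then show ?thesis using m st w' sum_array_in_array_space by cases blast+
qed

text \<open>Every \<open>sum_array\<close> satisfies this relation between four positions, and it
  survives in the closure because one box contains them all.\<close>

lemma array_space_additive:
  assumes "z \<in> array_space"
  shows "z (1, 1, k) = (z (0, 0, k) \<noteq> (z (1, 0, k) \<noteq> z (0, 1, k)))"
proof -
  from assms obtain s t where "agree_on_box 1 (sum_array s t (\<lambda>_. False)) z" unfolding array_space_iff by blast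
  then have "z (i, j, k) = sum_array s t (\<lambda>_. False) (i, j, k)" if "\<bar>i\<bar> < 9" "\<bar>j\<bar> < 9" for i j
    using that unfolding agree_on_box_def by simp
  then show ?thesis by (auto simp: sum_array_apply)
qed

text \<open>Renumbering the countable index set by natural numbers turns the array space into a
  nonempty closed perfect subset of the Cantor space.\<close>

lemma homeomorphism_array_space:
  obtains \<psi> :: "arr \<Rightarrow> nat \<Rightarrow> bool" and \<phi> where "homeomorphism array_space UNIV \<psi> \<phi>"
proof -
  define e where "e = from_nat_into (UNIV :: (int \<times> int \<times> bool) set)"
  have "infinite (UNIV :: (int \<times> int \<times> bool) set)" by (simp add: finite_prod infinite_UNIV_char_0)
  then have e: "bij e" unfolding e_def by (intro bij_betw_from_nat_into) simp_all
  have e1: "e (inv e i) = i" "inv e (e n) = n" for i n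
    using e by (simp_all add: bij_is_surj surj_f_inv_f bij_is_inj)
  define R where "R z = z \<circ> e" for z :: arr
  define R' where "R' x = x \<circ> inv e" for x :: "nat \<Rightarrow> bool"
  have RR: "R' (R z) = z" "R (R' x) = x" for z x by (simp_all add: R_def R'_def fun_eq_iff e1)
  have contR: "continuous_on A R" "continuous_on B R'" for A B
    unfolding continuous_on_into_fun_bool_iff R_def R'_def o_def
    by (auto intro: continuous_on_product_coordinates continuous_on_subset)
  define C where "C = R ` array_space"
  have "homeomorphism array_space C R R'"
    unfolding homeomorphism_def C_def by (auto simp: RR contR image_image)
  moreover obtain f g where "homeomorphism C UNIV f (g :: (nat \<Rightarrow> bool) \<Rightarrow> nat \<Rightarrow> bool)"
  proof (rule homeomorphism_perfect_cantor)
    show "C \<noteq> {}" unfolding C_def using sum_array_in_array_space by blast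
    have "C = R' -` array_space"
    proof (intro equalityI subsetI)
      fix x assume "x \<in> R' -` array_space"
      then show "x \<in> C" unfolding C_def using RR(2)[of x] by (intro image_eqI[of _ _ "R' x"]) simp_all
    qed (auto simp: C_def RR)
    then show "closed C" using closed_vimage[OF closed_array_space contR(2)] by simp
    fix x J assume x: "x \<in> C" "finite (J :: nat set)"
    then obtain z where z: "z \<in> array_space" "x = R z" unfolding C_def by blast
    obtain w where w: "w \<in> array_space" "w \<noteq> z" "\<forall>i\<in>e ` J. w i = z i"
      using array_space_perfect[OF z(1), of "e ` J"] x(2) by blast
    then have "R w \<noteq> x" using RR(1) z(2) by metis
    moreover have "\<forall>i\<in>J. R w i = x i" using w(3) z(2) by (simp add: R_def)
    ultimately show "\<exists>y\<in>C. y \<noteq> x \<and> (\<forall>i\<in>J. y i = x i)" unfolding C_def using w(1) by blast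
  qed
  ultimately show thesis using that homeomorphism_compose by blast
qed

lemma open_closed_Collect:
  fixes p :: "'a :: topological_space \<Rightarrow> bool"
  assumes "continuous_on UNIV p"
  shows "open {x. p x}" "closed {x. p x}"
proof -
  have "{x. p x} = p -` {True}" "- {x. p x} = p -` {False}" by auto
  then show "open {x. p x}" "closed {x. p x}"
    using open_vimage[OF _ assms, of "{True}"] open_vimage[OF _ assms, of "{False}"]
    by (simp_all add: open_discrete closed_def)
qed

lemma continuous_on_shift: "continuous_on A (shift \<gamma>)"
  unfolding continuous_on_into_fun_bool_iff shift_def
  by (auto simp: case_prod_beta intro: continuous_on_product_coordinates continuous_on_subset)

section \<open>Transport to the Cantor space and conclusion\<close>

theorem theoremt:
  shows "\<exists>\<alpha>. Z2_action \<alpha> \<and> free_action \<alpha> \<and> minimal_action \<alpha> \<and>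
           \<not> (\<exists>H. is_subgroup H \<and> H \<subseteq> TFG \<alpha> \<and> locally_finite_group H \<and>
                (subtopology homeo_topology (TFG \<alpha>)) closure_of H = TFG \<alpha>)"
proof -
  obtain \<psi> :: "arr \<Rightarrow> cantor" and \<phi> where hom: "homeomorphism array_space UNIV \<psi> \<phi>"
    by (rule homeomorphism_array_space)
  have \<phi>: "\<phi> x \<in> array_space" and \<psi>\<phi>: "\<psi> (\<phi> x) = x" for x using hom unfolding homeomorphism_def by auto
  have \<phi>\<psi>: "\<phi> (\<psi> z) = z" if "z \<in> array_space" for z using hom that unfolding homeomorphism_def by auto
  have cont_\<psi>: "continuous_on array_space \<psi>" and cont_\<phi>: "continuous_on UNIV \<phi>"
    using hom unfolding homeomorphism_def by auto
  define \<alpha> where "\<alpha> \<gamma> x = \<psi> (shift \<gamma> (\<phi> x))" for \<gamma> x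
  have \<phi>\<alpha>: "\<phi> (\<alpha> \<gamma> x) = shift \<gamma> (\<phi> x)" for \<gamma> x
    unfolding \<alpha>_def by (intro \<phi>\<psi> shift_array_space \<phi>)
  have \<alpha>\<psi>: "\<alpha> \<gamma> (\<psi> z) = \<psi> (shift \<gamma> z)" if "z \<in> array_space" for \<gamma> z
    unfolding \<alpha>_def using \<phi>\<psi> that by simp
  have act: "Z2_action \<alpha>" unfolding Z2_action_def
  proof (intro conjI allI)
    show "continuous_on UNIV (\<alpha> \<gamma>)" for \<gamma>
      unfolding \<alpha>_def
      by (rule continuous_on_compose2[OF cont_\<psi> continuous_on_compose2[OF continuous_on_shift cont_\<phi>]])
        (auto intro: shift_array_space \<phi>)
    show "\<alpha> (0, 0) = id" by (simp add: \<alpha>_def shift_zero \<psi>\<phi> fun_eq_iff)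
    show "\<alpha> (a + c, b + d) = \<alpha> (a, b) \<circ> \<alpha> (c, d)" for a b c d
    proof
      fix x
      have "\<alpha> (a, b) (\<alpha> (c, d) x) = \<psi> (shift (a, b) (shift (c, d) (\<phi> x)))"
        unfolding \<alpha>_def[of "(a, b)"] \<phi>\<alpha> ..
      then show "\<alpha> (a + c, b + d) x = (\<alpha> (a, b) \<circ> \<alpha> (c, d)) x" by (simp add: \<alpha>_def[of "(a + c, b + d)"] shift_add)
    qed
  qed
  have free: "free_action \<alpha>" unfolding free_action_def
  proof (intro allI impI)
    fix \<gamma> x assume "\<alpha> \<gamma> x = x"
    then have "shift \<gamma> (\<phi> x) = \<phi> x" by (metis \<phi>\<alpha>)
    then show "\<gamma> = (0, 0)" using array_space_free[OF \<phi>[of x], of "fst \<gamma>" "snd \<gamma>"] by (simp add: prod_eq_iff)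
  qed
  have minimal: "minimal_action \<alpha>" unfolding minimal_action_def
  proof (intro allI)
    fix x
    have "y \<in> closure (range (\<lambda>\<gamma>. \<alpha> \<gamma> x))" for y
      unfolding closure_fun_bool_iff
    proof (intro allI impI)
      fix J :: "nat set" assume J: "finite J"
      have "continuous_on array_space (\<lambda>z. \<forall>i\<in>J. \<psi> z i = y i)"
      proof (rule continuous_on_Ball[OF J])
        fix i
        have "continuous_on array_space (\<lambda>z. \<psi> z i)" by (rule continuous_on_product_then_coordinatewise[OF cont_\<psi>])
        from continuous_on_discrete_combine[OF this this, of "\<lambda>a _. a = y i"]
        show "continuous_on array_space (\<lambda>z. \<psi> z i = y i)" .
      qed
      then obtain K where K: "finite K" "\<forall>z\<in>array_space. (\<forall>i\<in>K. z i = \<phi> y i) \<longrightarrow>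
          (\<forall>i\<in>J. \<psi> z i = y i) = (\<forall>i\<in>J. \<psi> (\<phi> y) i = y i)"
        by (rule continuous_on_fun_boolE[OF _ \<phi>[of y]])
      obtain m where m: "\<forall>z w. agree_on_box m z w \<longrightarrow> (\<forall>i\<in>K. z i = w i)" by (rule agree_finite[OF K(1)])
      obtain \<gamma> where "agree_on_box m (shift \<gamma> (\<phi> x)) (\<phi> y)" using array_space_minimal[OF \<phi> \<phi>] by blast
      with m have "\<forall>i\<in>K. shift \<gamma> (\<phi> x) i = \<phi> y i" by blast
      then have "\<forall>i\<in>J. \<alpha> \<gamma> x i = y i"
        using bspec[OF K(2) shift_array_space[OF \<phi>[of x], of \<gamma>]] by (simp add: \<alpha>_def \<psi>\<phi>)
      then show "\<exists>z\<in>range (\<lambda>\<gamma>. \<alpha> \<gamma> x). \<forall>i\<in>J. z i = y i" by blast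
    qed
    then show "closure (range (\<lambda>\<gamma>. \<alpha> \<gamma> x)) = UNIV" by blast
  qed
  \<comment> \<open>By \<open>array_space_additive\<close> the horizontal difference of the second
    coordinate is invariant under \<open>(0, 1)\<close>, and the vertical difference of the first
    coordinate under \<open>(1, 0)\<close>. Hence, modulo 2, the differences of the indicators of
    \<open>P\<close> along \<open>(0, 1)\<close> and of \<open>Q\<close> along \<open>(1, 0)\<close>
    are both the product of these two differences.\<close>
  define P where "P = {x. \<phi> x (0, 0, False) \<and> \<phi> x (1, 0, True) \<noteq> \<phi> x (0, 0, True)}"
  define Q where "Q = {x. \<phi> x (0, 1, False) \<noteq> \<phi> x (0, 0, False) \<and> \<phi> x (0, 0, True)}"
  have coord: "continuous_on UNIV (\<lambda>x. \<phi> x i)" for i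
    by (rule continuous_on_product_then_coordinatewise[OF cont_\<phi>])
  have P: "open P" "closed P" and Q: "open Q" "closed Q"
    unfolding P_def Q_def
    by (rule open_closed_Collect continuous_on_discrete_combine[where H = "(\<and>)"]
        continuous_on_discrete_combine[where H = "(\<noteq>)"] coord)+
  have cocycle: "even (of_bool (\<alpha> (0, 1) x \<in> P) - of_bool (x \<in> P)
        - (of_bool (\<alpha> (1, 0) x \<in> Q) - of_bool (x \<in> Q)) :: int)" for x
  proof -
    have "\<phi> x (1, 1, k) = (\<phi> x (0, 0, k) \<noteq> (\<phi> x (1, 0, k) \<noteq> \<phi> x (0, 1, k)))" for k
      by (rule array_space_additive[OF \<phi>])
    then show ?thesis unfolding P_def Q_def mem_Collect_eq \<phi>\<alpha> shift_apply by (auto simp: of_bool_def)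
  qed
  have no_lift: False
    if E: "continuous_on UNIV E" and F: "continuous_on UNIV F"
      and EF: "\<And>x. E (\<alpha> (0, 1) x) - E x = F (\<alpha> (1, 0) x) - F x"
      and EP: "\<And>x. even (E x - of_bool (x \<in> P))" for E F :: "cantor \<Rightarrow> int"
  proof -
    have *: "continuous_on array_space (\<lambda>z. E (\<psi> z))" "continuous_on array_space (\<lambda>z. F (\<psi> z))"
      using continuous_on_compose2[OF E cont_\<psi>] continuous_on_compose2[OF F cont_\<psi>] by auto
    obtain J where J: "finite J"
      "\<forall>x\<in>array_space. \<forall>y\<in>array_space. (\<forall>i\<in>J. y i = x i) \<longrightarrow> E (\<psi> y) = E (\<psi> x)"
      by (rule continuous_on_closed_uniform[OF closed_array_space *(1)])
    obtain K where K: "finite K"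
      "\<forall>x\<in>array_space. \<forall>y\<in>array_space. (\<forall>i\<in>K. y i = x i) \<longrightarrow> F (\<psi> y) = F (\<psi> x)"
      by (rule continuous_on_closed_uniform[OF closed_array_space *(2)])
    \<comment> \<open>A single box size \<open>m\<close> decides the values of both \<open>E\<close>
      and \<open>F\<close>.\<close>
    have "finite (J \<union> K)" using J K by simp
    then obtain m where m: "\<forall>z w. agree_on_box m z w \<longrightarrow> (\<forall>i\<in>J \<union> K. z i = w i)" by (rule agree_finite)
    have loc: "E (\<psi> z) = E (\<psi> w)" "F (\<psi> z) = F (\<psi> w)"
      if "agree_on_box m z w" "z \<in> array_space" "w \<in> array_space" for z w
    proof -
      have "\<forall>i\<in>J. z i = w i" "\<forall>i\<in>K. z i = w i" using m that(1) by blast+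
      then show "E (\<psi> z) = E (\<psi> w)" "F (\<psi> z) = F (\<psi> w)" using J(2) K(2) that(2,3) by blast+
    qed
    note mem = sum_array_in_array_space
    show False
    proof (rule no_integral_lift[of "\<lambda>s t g. E (\<psi> (sum_array s t g))" "\<lambda>s t g. F (\<psi> (sum_array s t g))" m])
      show "E (\<psi> (sum_array s (t + 1) g)) - E (\<psi> (sum_array s t g)) =
        F (\<psi> (sum_array (s + 1) t g)) - F (\<psi> (sum_array s t g))" for s t g
        using EF[of "\<psi> (sum_array s t g)"] by (simp add: \<alpha>\<psi> mem shift_sum_array)
      show "even (E (\<psi> (sum_array s t g)) - of_bool ((morse False s \<noteq> (morse False t \<noteq> g False)) \<and>
        morse True (s + 1) \<noteq> morse True s))" for s t g
      proof -
        have "\<psi> (sum_array s t g) \<in> P \<longleftrightarrow> (morse False s \<noteq> (morse False t \<noteq> g False)) \<and>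
          morse True (s + 1) \<noteq> morse True s"
          by (auto simp: P_def \<phi>\<psi> mem sum_array_apply add.commute)
        then show ?thesis using EP[of "\<psi> (sum_array s t g)"] by simp
      qed
      show "E (\<psi> (sum_array s t g)) = E (\<psi> (sum_array s t' g'))"
        if "\<And>k j. - (9 ^ m) \<le> j \<Longrightarrow> j < 9 ^ m \<Longrightarrow> (morse k (t + j) \<noteq> g k) = (morse k (t' + j) \<noteq> g' k)"
        for s t t' g g'
      proof (rule loc(1)[OF _ mem mem], unfold agree_on_box_def sum_array_apply, intro allI impI)
        fix i j :: int and k assume "\<bar>j\<bar> < 9 ^ m"
        then have "- (9 ^ m) \<le> j" "j < 9 ^ m" by linarith+
        then show "(morse k (i + s) \<noteq> (morse k (j + t) \<noteq> g k)) = (morse k (i + s) \<noteq> (morse k (j + t') \<noteq> g' k))"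
          using that[of j k] by (auto simp: add.commute)
      qed
      show "F (\<psi> (sum_array s t g)) = F (\<psi> (sum_array s' t g'))"
        if "\<And>k j. - (9 ^ m) \<le> j \<Longrightarrow> j < 9 ^ m \<Longrightarrow> (morse k (s + j) \<noteq> g k) = (morse k (s' + j) \<noteq> g' k)"
        for s s' t g g'
      proof (rule loc(2)[OF _ mem mem], unfold agree_on_box_def sum_array_apply, intro allI impI)
        fix i j :: int and k assume "\<bar>i\<bar> < 9 ^ m"
        then have "- (9 ^ m) \<le> i" "i < 9 ^ m" by linarith+
        then show "(morse k (i + s) \<noteq> (morse k (j + t) \<noteq> g k)) = (morse k (i + s') \<noteq> (morse k (j + t) \<noteq> g' k))"
          using that[of i k] by (auto simp: add.commute)
      qed
    qed
  qed
  show ?thesis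
  proof (intro exI[of _ \<alpha>] conjI notI act free minimal)
    assume "\<exists>H. is_subgroup H \<and> H \<subseteq> TFG \<alpha> \<and> locally_finite_group H \<and>
      (subtopology homeo_topology (TFG \<alpha>)) closure_of H = TFG \<alpha>"
    then obtain H where H: "is_subgroup H" "H \<subseteq> TFG \<alpha>" "locally_finite_group H"
      "(subtopology homeo_topology (TFG \<alpha>)) closure_of H = TFG \<alpha>" by blast
    show False
    proof (rule no_dense_locally_finite_subgroup[OF act free P Q cocycle _ H])
      fix E F :: "cantor \<Rightarrow> int"
      assume "continuous_on UNIV E" "continuous_on UNIV F"
        "\<And>x. E (\<alpha> (0, 1) x) - E x = F (\<alpha> (1, 0) x) - F x"
        "\<And>x. even (E x - of_bool (x \<in> P))"
      then show False by (rule no_lift)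
    qed
  qed
qed

end
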